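(* Let $\mathcal{E}_1,\mathcal{E}_2$ be probabilistic concurrent programs over a finite state space $\Omega$, let $r_1,r_2,g,g'\in\mathbb{H}_1\Omega$ with $r_1\cap r_2\in\mathbb{H}_1\Omega$, where $(r_1\cap r_2)(s)=r_1(s)\cap r_2(s)$, and let $p_1,p_2\in[0,1]$. For every initial state $s_0\in\Omega$ and all subsets $O_1,O_2\subseteq\Omega$: if $$[\![r_1^{*}\|\mathcal{E}_1]\!](s_0)(O_1)\ge p_1,\quad[\![r_2^{*}\|\mathcal{E}_2]\!](s_0)(O_2)\ge p_2,\quad\mathcal{E}_1\sqsubseteq_{\mathrm{sim}}g^{*}\sqsubseteq_{\mathrm{sim}}r_2^{*},\quad\mathcal{E}_2\sqsubseteq_{\mathrm{sim}}g'^{*}\sqsubseteq_{\mathrm{sim}}r_1^{*},$$ then $$[\![(r_1\cap r_2)^{*}\|\mathcal{E}_1\|\mathcal{E}_2]\!](s_0)(O_1\cap O_2)\ge p_1+p_2-1\quad\text{and}\quad\mathcal{E}_1\|\mathcal{E}_2\sqsubseteq_{\mathrm{sim}}(g+g')^{*},$$ where $g+g'$ is the nondeterministic choice in $\mathbb{H}_1\Omega$.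
   Context: **Programs.** $\Omega$ is a fixed finite set of states. $\mathbb{D}\Omega$ is the set of distributions on $\Omega$, viewed inside $\mathbb{R}^\Omega$, and $\mu(O)=\sum_{s\in O}\mu(s)$; $\mathbb{D}_{\le 1}\Omega$ is the set of subdistributions; $\delta_s$ is the point distribution at $s$. $\mathbb{H}_1\Omega$ is the set of maps $r:\Omega\to\mathcal{P}(\mathbb{D}\Omega)$ such that each $r(s)$ is non-empty, convex and topologically closed. A test is a map $b:\Omega\to\mathcal{P}(\mathbb{D}\Omega)$ with $b(s)\subseteq\{\delta_s\}$. $\overline{\mathbb{H}}_1\Omega$ is $\mathbb{H}_1\Omega$ together with all tests, ordered by $r\sqsubseteq_{\mathbb{H}}r'$ iff $r(s)\subseteq r'(s)$ for all $s$. $\delta$ denotes the program $\delta(s)=\{\delta_s\}$. On $\mathbb{H}_1\Omega$, $(g+g')(s)=\{(1-p)\mu+p\mu':p\in[0,1],\mu\in g(s),\mu'\in g'(s)\}$. **ipBES.** A bundle event structure with internal probability (ipBES) is $\mathcal{E}=(E,\mapsto,\#,\lambda,\mathbf{\Phi})$ where $E$ is a set of events; $\#$ is an irreflexive symmetric relation on $E$; for $x,x'\subseteq E$, $x\#x'$ means $e\#e'$ for all $e\in x,e'\in x'$ with $e\ne e'$; $\mapsto\subseteq\mathcal{P}(E)\times E$ satisfies $x\#x$ whenever $x\mapsto e$; $\lambda:E\to\overline{\mathbb{H}}_1\Omega$; $\mathbf{\Phi}\subseteq\mathcal{P}(E)$ with $x\#x$ for $x\in\mathbf{\Phi}$. **Traces.**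 A finite trace is a finite sequence $e_1\cdots e_n$ of distinct, pairwise non-conflicting events such that for every $j$ and every bundle $x\mapsto e_j$ there is $i<j$ with $e_i\in x$. $\mathcal{T}(\mathcal{E})$ is the set of finite traces (empty trace $\emptyset$), $\mathcal{T}_{\max}(\mathcal{E})$ the set of prefix-maximal ones. A trace $\alpha$ is weakly maximal if it is maximal or there are events $e_1,\dots,e_n$ with $\alpha e_1\cdots e_n\in\mathcal{T}_{\max}(\mathcal{E})$ and $\delta\sqsubseteq_{\mathbb{H}}\lambda(e_i)$ for all $i$. **Schedulers and semantics.** A scheduler $\sigma$ on $\mathcal{E}$ assigns to each $\alpha\in\mathcal{T}(\mathcal{E})$ a partial function $\sigma(\alpha):E\times\Omega\rightharpoonup\mathbb{D}_{\le1}\Omega$ with domain $\{(e,s):\alpha e\in\mathcal{T}(\mathcal{E}),\,s\in\Omega\}$ for which there is $w:E\times\Omega\to[0,1]$ (depending on $\alpha$) such that for $(e,s)$ in the domain: if $\lambda(e)(s)\neq\emptyset$ then $\sigma(\alpha)(e,s)=w(e,s)\mu$ for some $\mu\in\lambda(e)(s)$; if $\lambda(e)(s)=\emptyset$ then $w(e,s)=0$ and $\sigma(\alpha)(e,s)=0$; and, when the domain is non-empty, $\sum_{e:\alpha e\in\mathcal{T}(\mathcal{E})}w(e,s)=1$ for every $s$. From initial state $s$, define $\varphi_s(\emptyset)=\delta_s$, $\varphi_s(\alpha e)(u)=\sum_{t\in\Omega}\sigma(\alpha)(e,t)(u)\varphi_s(\alpha)(t)$, and $\sigma_s(\mathcal{E})=\sum_{\alpha\in\mathcal{T}_{\max}(\mathcal{E})}\varphi_s(\alpha)$.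 $\mathbf{Sched}_1(\mathcal{E})$ is the set of schedulers $\sigma$ such that $\sigma_s(\mathcal{E})$ is a distribution for every $s$. $\mathcal{E}$ is feasible if for every $\alpha\in\mathcal{T}(\mathcal{E})\setminus\mathcal{T}_{\max}(\mathcal{E})$, $\bigcup_{\alpha e\in\mathcal{T}(\mathcal{E})}\{s:\lambda(e)(s)\ne\emptyset\}=\Omega$; it is terminating if $\mathbf{Sched}_1(\mathcal{E})\neq\emptyset$. $[\![\mathcal{E}]\!](s)$ is the topological closure of the convex hull of $\{\sigma_s(\mathcal{E}):\sigma\in\mathbf{Sched}_1(\mathcal{E})\}$. For $O\subseteq\Omega$ and a real number $p$, $[\![\mathcal{E}]\!](s_0)(O)\ge p$ means $\mu(O)\ge p$ for every $\mu\in[\![\mathcal{E}]\!](s_0)$. A probabilistic concurrent program is a feasible and terminating ipBES. **t-simulation.** A function $f:\mathcal{T}(\mathcal{E})\to\mathcal{T}(\mathcal{F})$ is a t-simulation if: (i) $f(\emptyset)=\emptyset$ and $f^{-1}(\beta)$ is finite for every $\beta\in\mathcal{T}(\mathcal{F})$; (ii) if $\alpha e\in\mathcal{T}(\mathcal{E})$ then either $f(\alpha e)=f(\alpha)$ and $\lambda(e)\sqsubseteq_{\mathbb{H}}\delta$, or there is an event $e'$ of $\mathcal{F}$ with $\lambda(e)\sqsubseteq_{\mathbb{H}}\lambda(e')$ and $f(\alpha e)=f(\alpha)e'$; (iii) if $\alpha e$ is maximal in $\mathcal{T}(\mathcal{E})$ then $f(\alpha e)=f(\alpha)e'$ for some $e'$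 with $\lambda(e)\sqsubseteq_{\mathbb{H}}\lambda(e')$, and $f(\alpha e)$ is weakly maximal in $\mathcal{T}(\mathcal{F})$. $\mathcal{E}\sqsubseteq_{\mathrm{sim}}\mathcal{F}$ means there is a t-simulation from $\mathcal{E}$ to $\mathcal{F}$. **Operations on ipBES** (event sets of the operands are taken disjoint, using fresh copies if necessary). - $\mathcal{E}\|\mathcal{F}=(E\cup F,\ \mapsto_{\mathcal{E}}\cup\mapsto_{\mathcal{F}},\ \#_{\mathcal{E}}\cup\#_{\mathcal{F}},\ \lambda_{\mathcal{E}}\cup\lambda_{\mathcal{F}},\ \mathbf{\Phi}_{\mathcal{E}}\cup\mathbf{\Phi}_{\mathcal{F}})$ (associative up to renaming). - For $r\in\mathbb{H}_1\Omega$, $r^{*}$ (the binary Kleene star $r*1$, i.e. the limit of $1,\ 1+r\cdot1,\ 1+r\cdot(1+r\cdot 1),\dots$ in event structures, $1$ being a single event labelled $\delta$) is explicitly the ipBES with events $a_k$ (label $r$) and $d_k$ (label $\delta$), $k\ge0$; bundles $\{a_k\}\mapsto a_{k+1}$ and $\{a_k\}\mapsto d_{k+1}$; conflicts $a_k\#d_k$ for all $k$ and $d_j\#d_k$ for $j\neq k$; and the single exit set $\{d_k:k\ge0\}$. *)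

theory Defs
  imports "HOL-Analysis.Analysis"
begin

section \<open>Sequential probabilistic programs\<close>

text \<open>The state space is a type \<open>'s\<close> of class \<open>finite\<close>, and distributions are vectors in
  \<open>real ^ 's\<close>, so that \<open>convex\<close>, \<open>closed\<close>, \<open>closure\<close> and \<open>convex hull\<close> are those of
  Euclidean space.\<close>

definition distributions :: "(real ^ 's::finite) set" where
  "distributions = {\<mu>. (\<forall>s. 0 \<le> \<mu> $ s) \<and> (\<Sum>s\<in>UNIV. \<mu> $ s) = 1}"

definition subdistributions :: "(real ^ 's::finite) set" where
  "subdistributions = {\<mu>. (\<forall>s. 0 \<le> \<mu> $ s) \<and> (\<Sum>s\<in>UNIV. \<mu> $ s) \<le> 1}"

definition point :: "'s::finite \<Rightarrow> real ^ 's" where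
  "point s = axis s 1"

definition mass :: "real ^ 's::finite \<Rightarrow> 's set \<Rightarrow> real" where
  "mass \<mu> O' = (\<Sum>s\<in>O'. \<mu> $ s)"

type_synonym 's prog = "'s \<Rightarrow> (real ^ 's) set"

definition H1 :: "'s::finite prog set" where
  "H1 = {r. \<forall>s. r s \<subseteq> distributions \<and> r s \<noteq> {} \<and> convex (r s) \<and> closed (r s)}"

definition tests :: "'s::finite prog set" where
  "tests = {b. \<forall>s. b s \<subseteq> {point s}}"

definition H1_bar :: "'s::finite prog set" where
  "H1_bar = H1 \<union> tests"

definition prog_le :: "'s::finite prog \<Rightarrow> 's prog \<Rightarrow> bool"  (infix "\<sqsubseteq>\<^sub>H" 50) where
  "r \<sqsubseteq>\<^sub>H r' \<longleftrightarrow> (\<forall>s. r s \<subseteq> r' s)"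

definition skip :: "'s::finite prog" where
  "skip s = {point s}"

definition choice :: "'s::finite prog \<Rightarrow> 's prog \<Rightarrow> 's prog" where
  "choice g g' s =
     {(1 - p) *\<^sub>R \<mu> + p *\<^sub>R \<mu>' | p \<mu> \<mu>'. p \<in> {0..1} \<and> \<mu> \<in> g s \<and> \<mu>' \<in> g' s}"

definition meet :: "'s::finite prog \<Rightarrow> 's prog \<Rightarrow> 's prog" where
  "meet r r' s = r s \<inter> r' s"


section \<open>Bundle event structures with internal probability\<close>

record ('e, 's::finite) ipbes =
  events :: "'e set"
  bundles :: "('e set \<times> 'e) set"
  conflict :: "('e \<times> 'e) set"
  label :: "'e \<Rightarrow> 's prog"
  exits :: "'e set set"

definition set_conflict :: "('e, 's::finite) ipbes \<Rightarrow> 'e set \<Rightarrow> 'e set \<Rightarrow> bool" where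
  "set_conflict \<E> x x' \<longleftrightarrow> (\<forall>e\<in>x. \<forall>e'\<in>x'. e \<noteq> e' \<longrightarrow> (e, e') \<in> conflict \<E>)"

definition is_ipbes :: "('e, 's::finite) ipbes \<Rightarrow> bool" where
  "is_ipbes \<E> \<longleftrightarrow>
     conflict \<E> \<subseteq> events \<E> \<times> events \<E> \<and> irrefl (conflict \<E>) \<and> sym (conflict \<E>) \<and>
     bundles \<E> \<subseteq> Pow (events \<E>) \<times> events \<E> \<and>
     (\<forall>x e. (x, e) \<in> bundles \<E> \<longrightarrow> set_conflict \<E> x x) \<and>
     (\<forall>e\<in>events \<E>. label \<E> e \<in> H1_bar) \<and>
     exits \<E> \<subseteq> Pow (events \<E>) \<and> (\<forall>x\<in>exits \<E>. set_conflict \<E> x x)"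


subsection \<open>Traces\<close>

definition traces :: "('e, 's::finite) ipbes \<Rightarrow> 'e list set" where
  "traces \<E> = {\<alpha>. set \<alpha> \<subseteq> events \<E> \<and> distinct \<alpha> \<and>
     (\<forall>e\<in>set \<alpha>. \<forall>e'\<in>set \<alpha>. (e, e') \<notin> conflict \<E>) \<and>
     (\<forall>j<length \<alpha>. \<forall>x. (x, \<alpha> ! j) \<in> bundles \<E> \<longrightarrow> (\<exists>i<j. \<alpha> ! i \<in> x))}"

definition max_traces :: "('e, 's::finite) ipbes \<Rightarrow> 'e list set" where
  "max_traces \<E> = {\<alpha> \<in> traces \<E>. \<forall>\<gamma>. \<alpha> @ \<gamma> \<in> traces \<E> \<longrightarrow> \<gamma> = []}"

definition weakly_maximal :: "('e, 's::finite) ipbes \<Rightarrow> 'e list \<Rightarrow> bool" where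
  "weakly_maximal \<E> \<alpha> \<longleftrightarrow> \<alpha> \<in> traces \<E> \<and>
     (\<alpha> \<in> max_traces \<E> \<or>
      (\<exists>es. \<alpha> @ es \<in> max_traces \<E> \<and> (\<forall>e\<in>set es. skip \<sqsubseteq>\<^sub>H label \<E> e)))"

definition enabled :: "('e, 's::finite) ipbes \<Rightarrow> 'e list \<Rightarrow> 'e set" where
  "enabled \<E> \<alpha> = {e. \<alpha> @ [e] \<in> traces \<E>}"


subsection \<open>Schedulers and semantics\<close>

text \<open>Only the values of a scheduler on \<open>traces \<E>\<close> matter.  The event set may be infinite, hence
  \<open>has_sum\<close> in the normalisation of the weights.\<close>

type_synonym ('e, 's) sched = "'e list \<Rightarrow> ('e \<times> 's) \<rightharpoonup> (real ^ 's)"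

definition scheduler :: "('e, 's::finite) ipbes \<Rightarrow> ('e, 's) sched \<Rightarrow> bool" where
  "scheduler \<E> \<sigma> \<longleftrightarrow> (\<forall>\<alpha>\<in>traces \<E>.
     dom (\<sigma> \<alpha>) = enabled \<E> \<alpha> \<times> UNIV \<and> ran (\<sigma> \<alpha>) \<subseteq> subdistributions \<and>
     (\<exists>w :: 'e \<times> 's \<Rightarrow> real.
        (\<forall>e\<in>events \<E>. \<forall>s. w (e, s) \<in> {0..1}) \<and>
        (\<forall>e\<in>enabled \<E> \<alpha>. \<forall>s.
           (label \<E> e s \<noteq> {} \<longrightarrow>
              (\<exists>\<mu>\<in>label \<E> e s. \<sigma> \<alpha> (e, s) = Some (w (e, s) *\<^sub>R \<mu>))) \<and>
           (label \<E> e s = {} \<longrightarrow> w (e, s) = 0 \<and> \<sigma> \<alpha> (e, s) = Some 0)) \<and>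
        (enabled \<E> \<alpha> \<noteq> {} \<longrightarrow>
           (\<forall>s. ((\<lambda>e. w (e, s)) has_sum 1) (enabled \<E> \<alpha>)))))"

function phi :: "('e, 's::finite) sched \<Rightarrow> 's \<Rightarrow> 'e list \<Rightarrow> real ^ 's" where
  "phi \<sigma> s [] = point s"
| "phi \<sigma> s (\<alpha> @ [e]) =
     (\<chi> u. \<Sum>t\<in>UNIV. the (\<sigma> \<alpha> (e, t)) $ u * phi \<sigma> s \<alpha> $ t)"
  by (auto, metis rev_exhaust)
termination
  by (relation "Wellfounded.measure (\<lambda>(\<sigma>, s, \<alpha>). length \<alpha>)") auto

text \<open>For a scheduler the sum below is a sum of non-negative vectors of total mass at most 1, so it
  always converges; \<open>infsum\<close> of a divergent family would be 0, which is not a distribution.\<close>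

definition outcome :: "('e, 's::finite) ipbes \<Rightarrow> ('e, 's) sched \<Rightarrow> 's \<Rightarrow> real ^ 's" where
  "outcome \<E> \<sigma> s = infsum (phi \<sigma> s) (max_traces \<E>)"

definition Sched1 :: "('e, 's::finite) ipbes \<Rightarrow> ('e, 's) sched set" where
  "Sched1 \<E> = {\<sigma>. scheduler \<E> \<sigma> \<and> (\<forall>s. outcome \<E> \<sigma> s \<in> distributions)}"

definition feasible :: "('e, 's::finite) ipbes \<Rightarrow> bool" where
  "feasible \<E> \<longleftrightarrow> (\<forall>\<alpha>\<in>traces \<E> - max_traces \<E>.
     (\<Union>e\<in>enabled \<E> \<alpha>. {s. label \<E> e s \<noteq> {}}) = UNIV)"

definition terminating :: "('e, 's::finite) ipbes \<Rightarrow> bool" where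
  "terminating \<E> \<longleftrightarrow> Sched1 \<E> \<noteq> {}"

definition semantics :: "('e, 's::finite) ipbes \<Rightarrow> 's prog"  ("\<lbrakk>_\<rbrakk>") where
  "\<lbrakk>\<E>\<rbrakk> s = closure (convex hull {outcome \<E> \<sigma> s | \<sigma>. \<sigma> \<in> Sched1 \<E>})"

definition prob_ge :: "(real ^ 's::finite) set \<Rightarrow> 's set \<Rightarrow> real \<Rightarrow> bool" where
  "prob_ge M O' p \<longleftrightarrow> (\<forall>\<mu>\<in>M. mass \<mu> O' \<ge> p)"

definition concurrent_program :: "('e, 's::finite) ipbes \<Rightarrow> bool" where
  "concurrent_program \<E> \<longleftrightarrow> is_ipbes \<E> \<and> feasible \<E> \<and> terminating \<E>"


subsection \<open>Simulation\<close>

definition t_simulation ::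
    "('e, 's::finite) ipbes \<Rightarrow> ('f, 's) ipbes \<Rightarrow> ('e list \<Rightarrow> 'f list) \<Rightarrow> bool" where
  "t_simulation \<E> \<F> f \<longleftrightarrow>
     f \<in> traces \<E> \<rightarrow> traces \<F> \<and>
     f [] = [] \<and>
     (\<forall>\<beta>\<in>traces \<F>. finite {\<alpha> \<in> traces \<E>. f \<alpha> = \<beta>}) \<and>
     (\<forall>\<alpha> e. \<alpha> @ [e] \<in> traces \<E> \<longrightarrow>
        (f (\<alpha> @ [e]) = f \<alpha> \<and> label \<E> e \<sqsubseteq>\<^sub>H skip) \<or>
        (\<exists>e'\<in>events \<F>. label \<E> e \<sqsubseteq>\<^sub>H label \<F> e' \<and> f (\<alpha> @ [e]) = f \<alpha> @ [e'])) \<and>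
     (\<forall>\<alpha> e. \<alpha> @ [e] \<in> max_traces \<E> \<longrightarrow>
        (\<exists>e'\<in>events \<F>. label \<E> e \<sqsubseteq>\<^sub>H label \<F> e' \<and> f (\<alpha> @ [e]) = f \<alpha> @ [e']) \<and>
        weakly_maximal \<F> (f (\<alpha> @ [e])))"

definition simulated_by :: "('e, 's::finite) ipbes \<Rightarrow> ('f, 's) ipbes \<Rightarrow> bool"
    (infix "\<sqsubseteq>\<^sub>s\<^sub>i\<^sub>m" 50) where
  "\<E> \<sqsubseteq>\<^sub>s\<^sub>i\<^sub>m \<F> \<longleftrightarrow> (\<exists>f. t_simulation \<E> \<F> f)"


subsection \<open>Parallel composition and Kleene star\<close>

text \<open>Disjointness of the two event sets is obtained from the sum type.\<close>

definition par :: "('e, 's::finite) ipbes \<Rightarrow> ('f, 's) ipbes \<Rightarrow> ('e + 'f, 's) ipbes"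
    (infixl "\<parallel>" 65) where
  "\<E> \<parallel> \<F> = \<lparr>
     events = Inl ` events \<E> \<union> Inr ` events \<F>,
     bundles = {(Inl ` x, Inl e) | x e. (x, e) \<in> bundles \<E>} \<union>
               {(Inr ` x, Inr e) | x e. (x, e) \<in> bundles \<F>},
     conflict = {(Inl e, Inl e') | e e'. (e, e') \<in> conflict \<E>} \<union>
                {(Inr e, Inr e') | e e'. (e, e') \<in> conflict \<F>},
     label = case_sum (label \<E>) (label \<F>),
     exits = (`) Inl ` exits \<E> \<union> (`) Inr ` exits \<F>\<rparr>"

text \<open>\<open>Act k\<close> and \<open>Done k\<close> are the events \<open>a\<^sub>k\<close> (the loop body) and \<open>d\<^sub>k\<close> (leaving the loop).\<close>

datatype star_event = Act nat | Done nat

definition star :: "'s::finite prog \<Rightarrow> (star_event, 's) ipbes" where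
  "star r = \<lparr>
     events = UNIV,
     bundles = {({Act k}, Act (Suc k)) | k. True} \<union> {({Act k}, Done (Suc k)) | k. True},
     conflict = {(Act k, Done k) | k. True} \<union> {(Done k, Act k) | k. True} \<union>
                {(Done j, Done k) | j k. j \<noteq> k},
     label = (\<lambda>e. case e of Act k \<Rightarrow> r | Done k \<Rightarrow> skip),
     exits = {range Done}\<rparr>"

end

theory Submission
  imports Defs
begin

text \<open>Simulation is sound: if \<open>\<E>\<close> is simulated by a feasible, finitely branching \<open>\<F>\<close>, then lower
  probability bounds for \<open>\<F>\<close> hold for \<open>\<E>\<close>.  A scheduler on \<open>\<E>\<close> started in a distribution \<open>\<nu>\<close>
  induces a flow of probability along the traces of \<open>\<E>\<close>; the flow is pushed forward along the
  simulation, with the finite fibres collapsed, and a flow on the traces of \<open>\<F>\<close> is realised by a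
  scheduler.  If \<open>\<nu>\<close> has full support, this scheduler terminates from every state, and letting \<open>\<nu>\<close> tend
  to the point distribution at \<open>s\<^sub>0\<close> gives the bound at \<open>s\<^sub>0\<close>.

  Since the other component \<open>\<E>\<^sub>2\<close> is simulated by \<open>r\<^sub>1\<^sup>*\<close>, so is \<open>(r\<^sub>1 \<inter> r\<^sub>2)\<^sup>* \<parallel> \<E>\<^sub>2\<close>, whence
  the whole system is simulated by \<open>r\<^sub>1\<^sup>* \<parallel> \<E>\<^sub>1\<close>; likewise by \<open>r\<^sub>2\<^sup>* \<parallel> \<E>\<^sub>2\<close>.  Each outcome thus gives
  \<open>O\<^sub>1\<close> and \<open>O\<^sub>2\<close> at least \<open>p\<^sub>1\<close> and \<open>p\<^sub>2\<close>.\<close>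

section \<open>Traces\<close>

text \<open>A simulation may identify traces of different lengths, and a scheduler on \<F> sees only
  the identified trace and the current state. It has to average the decisions of the given scheduler
  with weights that depend on the initial state. Flows avoid such averages: they are unnormalised
  and add up over a fibre, and a division occurs only when a scheduler is recovered from a flow.
  Finite fibres serve twice. No flow is lost in endless stuttering, and because stars branch
  finitely, so does everything simulated by a star, which makes all balances finite sums. Both
  claims rest on one construction, \<open>merge\<close>. It turns simulations into the stars of
  \<open>g\<close> and \<open>g'\<close> into one into the star of \<open>choice g g'\<close> by
  adding up the numbers of loop bodies executed. For \<open>g\<close> and \<open>g'\<close> this is
  the second claim. For two simulations into the star of \<open>r\<close>, convexity gives
  \<open>choice r r = r\<close>, so the loop of \<open>r\<close> absorbs a component that it
  simulates.\<close>

lemma traces_Nil [simp]: "[] \<in> traces \<E>"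
  by (simp add: traces_def)

text \<open>No axiom of event structures is assumed of \<E>, hence both orders of a conflict and the
  pair \<open>(e, e)\<close> appear. Later arguments on traces recurse on the last event through
  this equivalence.\<close>

lemma traces_snoc:
  "\<alpha> @ [e] \<in> traces \<E> \<longleftrightarrow> \<alpha> \<in> traces \<E> \<and> e \<in> events \<E> \<and> e \<notin> set \<alpha> \<and> (e, e) \<notin> conflict \<E> \<and>
     (\<forall>e'\<in>set \<alpha>. (e, e') \<notin> conflict \<E> \<and> (e', e) \<notin> conflict \<E>) \<and>
     (\<forall>x. (x, e) \<in> bundles \<E> \<longrightarrow> (\<exists>e'\<in>set \<alpha>. e' \<in> x))"
proof -
  define P where "P \<beta> j \<longleftrightarrow> (\<forall>x. (x, \<beta> ! j) \<in> bundles \<E> \<longrightarrow> (\<exists>i<j. \<beta> ! i \<in> x))" for \<beta> j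
  have "P (\<alpha> @ [e]) j \<longleftrightarrow> P \<alpha> j" if "j < length \<alpha>" for j
  proof -
    have "(\<exists>i<j. (\<alpha> @ [e]) ! i \<in> x) \<longleftrightarrow> (\<exists>i<j. \<alpha> ! i \<in> x)" for x
      using that by (intro ex_cong1 conj_cong refl) (simp add: nth_append)
    then show ?thesis using that by (simp add: P_def nth_append)
  qed
  moreover have "P (\<alpha> @ [e]) (length \<alpha>) \<longleftrightarrow> (\<forall>x. (x, e) \<in> bundles \<E> \<longrightarrow> (\<exists>e'\<in>set \<alpha>. e' \<in> x))"
  proof -
    have "(\<exists>i<length \<alpha>. (\<alpha> @ [e]) ! i \<in> x) \<longleftrightarrow> (\<exists>e'\<in>set \<alpha>. e' \<in> x)" for x
      by (metis in_set_conv_nth nth_append_left)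
    then show ?thesis by (simp add: P_def)
  qed
  ultimately have "(\<forall>j<length (\<alpha> @ [e]). P (\<alpha> @ [e]) j) \<longleftrightarrow> (\<forall>j<length \<alpha>. P \<alpha> j) \<and>
      (\<forall>x. (x, e) \<in> bundles \<E> \<longrightarrow> (\<exists>e'\<in>set \<alpha>. e' \<in> x))"
    by (simp add: less_Suc_eq) blast
  then show ?thesis
    unfolding traces_def P_def mem_Collect_eq by (simp only:) auto
qed

lemma traces_snocD: "\<alpha> @ [e] \<in> traces \<E> \<Longrightarrow> \<alpha> \<in> traces \<E>"
  by (simp add: traces_snoc)

lemma traces_appendD: "\<alpha> @ \<gamma> \<in> traces \<E> \<Longrightarrow> \<alpha> \<in> traces \<E>"
proof (induction \<gamma> rule: rev_induct)
  case (snoc e \<gamma>)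
  then show ?case
    by (metis append_assoc traces_snocD)
qed simp

lemma traces_induct [consumes 1, case_names Nil snoc]:
  assumes "\<alpha> \<in> traces \<E>" and "P []"
    and "\<And>\<alpha> e. \<alpha> @ [e] \<in> traces \<E> \<Longrightarrow> \<alpha> \<in> traces \<E> \<Longrightarrow> P \<alpha> \<Longrightarrow> P (\<alpha> @ [e])"
  shows "P \<alpha>"
  using assms(1) by (induction \<alpha> rule: rev_induct) (auto intro: assms dest: traces_snocD)

lemma enabled_iff [simp]: "e \<in> enabled \<E> \<alpha> \<longleftrightarrow> \<alpha> @ [e] \<in> traces \<E>"
  by (simp add: enabled_def)

text \<open>Traces are prefix closed, so a proper extension yields a one-event extension by its
  first event.\<close>

lemma max_traces_iff: "\<alpha> \<in> max_traces \<E> \<longleftrightarrow> \<alpha> \<in> traces \<E> \<and> enabled \<E> \<alpha> = {}"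
proof -
  have "\<gamma> = []" if "enabled \<E> \<alpha> = {}" "\<alpha> @ \<gamma> \<in> traces \<E>" for \<gamma>
    using that traces_appendD[of "\<alpha> @ [hd \<gamma>]" "tl \<gamma>" \<E>] by (cases \<gamma>) auto
  then show ?thesis
    by (fastforce simp: max_traces_def)
qed

lemma max_tracesD: "\<alpha> \<in> max_traces \<E> \<Longrightarrow> \<alpha> \<in> traces \<E>"
  by (simp add: max_traces_iff)

lemma snoc_not_max: "\<alpha> @ [e] \<in> traces \<E> \<Longrightarrow> \<alpha> \<notin> max_traces \<E>"
  by (auto simp: max_traces_iff)

lemma weakly_maximal_iff:
  "weakly_maximal \<E> \<alpha> \<longleftrightarrow> (\<exists>es. \<alpha> @ es \<in> max_traces \<E> \<and> (\<forall>e\<in>set es. skip \<sqsubseteq>\<^sub>H label \<E> e))"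
proof
  assume "weakly_maximal \<E> \<alpha>"
  then show "\<exists>es. \<alpha> @ es \<in> max_traces \<E> \<and> (\<forall>e\<in>set es. skip \<sqsubseteq>\<^sub>H label \<E> e)"
    by (auto simp: weakly_maximal_def intro: exI[of _ "[]"])
next
  assume "\<exists>es. \<alpha> @ es \<in> max_traces \<E> \<and> (\<forall>e\<in>set es. skip \<sqsubseteq>\<^sub>H label \<E> e)"
  then show "weakly_maximal \<E> \<alpha>"
    by (auto simp: weakly_maximal_def dest: max_tracesD traces_appendD)
qed

subsection \<open>Parallel composition\<close>

fun lefts :: "('a + 'b) list \<Rightarrow> 'a list" where
  "lefts [] = []"
| "lefts (Inl a # \<gamma>) = a # lefts \<gamma>"
| "lefts (Inr b # \<gamma>) = lefts \<gamma>"

fun rights :: "('a + 'b) list \<Rightarrow> 'b list" where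
  "rights [] = []"
| "rights (Inl a # \<gamma>) = rights \<gamma>"
| "rights (Inr b # \<gamma>) = b # rights \<gamma>"

lemma lefts_append [simp]: "lefts (\<gamma> @ \<gamma>') = lefts \<gamma> @ lefts \<gamma>'"
  by (induction \<gamma> rule: lefts.induct) auto

lemma rights_append [simp]: "rights (\<gamma> @ \<gamma>') = rights \<gamma> @ rights \<gamma>'"
  by (induction \<gamma> rule: rights.induct) auto

lemma lefts_map_Inl [simp]: "lefts (map Inl xs) = xs"
  by (induction xs) auto

lemma rights_map_Inl [simp]: "rights (map Inl xs) = []"
  by (induction xs) auto

lemma Inl_in_set_iff: "Inl a \<in> set \<gamma> \<longleftrightarrow> a \<in> set (lefts \<gamma>)"
  by (induction \<gamma> rule: lefts.induct) auto

lemma Inr_in_set_iff: "Inr b \<in> set \<gamma> \<longleftrightarrow> b \<in> set (rights \<gamma>)"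
  by (induction \<gamma> rule: rights.induct) auto

lemma ex_Inl_in_set_iff: "(\<exists>x\<in>set \<gamma>. x \<in> Inl ` A) \<longleftrightarrow> (\<exists>a\<in>set (lefts \<gamma>). a \<in> A)"
  by (induction \<gamma> rule: lefts.induct) auto

lemma ex_Inr_in_set_iff: "(\<exists>x\<in>set \<gamma>. x \<in> Inr ` B) \<longleftrightarrow> (\<exists>b\<in>set (rights \<gamma>). b \<in> B)"
  by (induction \<gamma> rule: rights.induct) auto

lemma length_lefts_rights: "length \<gamma> = length (lefts \<gamma>) + length (rights \<gamma>)"
  by (induction \<gamma> rule: lefts.induct) auto

text \<open>A shuffle uses only the letters of its two words and has the sum of their lengths. This
  gives finite fibres for simulations of parallel compositions.\<close>

lemma finite_shuffles:
  assumes "finite A" "finite B"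
  shows "finite {\<gamma>. lefts \<gamma> \<in> A \<and> rights \<gamma> \<in> B}"
proof -
  define S where "S = Inl ` \<Union>(set ` A) \<union> Inr ` \<Union>(set ` B)"
  \<comment> \<open>\<open>insert 0\<close> keeps \<open>Max\<close> meaningful when one of the sets
    is empty.\<close>
  define n where "n = Max (insert 0 (length ` A)) + Max (insert 0 (length ` B))"
  have "finite {\<gamma>. set \<gamma> \<subseteq> S \<and> length \<gamma> \<le> n}"
    using assms by (intro finite_lists_length_le) (auto simp: S_def)
  moreover have "{\<gamma>. lefts \<gamma> \<in> A \<and> rights \<gamma> \<in> B} \<subseteq> {\<gamma>. set \<gamma> \<subseteq> S \<and> length \<gamma> \<le> n}"
  proof clarify
    fix \<gamma> :: "('a + 'b) list"
    assume \<gamma>: "lefts \<gamma> \<in> A" "rights \<gamma> \<in> B"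
    have "x \<in> S" if "x \<in> set \<gamma>" for x
    proof (cases x)
      case (Inl a)
      then have "a \<in> set (lefts \<gamma>)" using that by (simp add: Inl_in_set_iff)
      then show ?thesis using \<gamma> by (auto simp: S_def Inl)
    next
      case (Inr b)
      then have "b \<in> set (rights \<gamma>)" using that by (simp add: Inr_in_set_iff)
      then show ?thesis using \<gamma> by (auto simp: S_def Inr)
    qed
    moreover have "length \<gamma> \<le> n"
      unfolding n_def length_lefts_rights[of \<gamma>] using assms \<gamma> by (intro add_mono Max_ge) auto
    ultimately show "set \<gamma> \<subseteq> S \<and> length \<gamma> \<le> n" by auto
  qed
  ultimately show ?thesis by (rule finite_subset[rotated])
qed

lemma label_par [simp]:
  "label (\<E> \<parallel> \<F>) (Inl e) = label \<E> e" "label (\<E> \<parallel> \<F>) (Inr e') = label \<F> e'"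
  by (simp_all add: par_def)

text \<open>Neither a bundle nor a conflict crosses the two components, so their traces interleave
  freely.\<close>

lemma traces_par_iff: "\<gamma> \<in> traces (\<E> \<parallel> \<F>) \<longleftrightarrow> lefts \<gamma> \<in> traces \<E> \<and> rights \<gamma> \<in> traces \<F>"
proof (induction \<gamma> rule: rev_induct)
  case (snoc x \<gamma>)
  show ?case
  proof (cases x)
    case (Inl e)
    have "(\<forall>y. (y, Inl e) \<in> bundles (\<E> \<parallel> \<F>) \<longrightarrow> (\<exists>e'\<in>set \<gamma>. e' \<in> y)) \<longleftrightarrow>
        (\<forall>y. (y, e) \<in> bundles \<E> \<longrightarrow> (\<exists>e'\<in>set (lefts \<gamma>). e' \<in> y))"
      unfolding ex_Inl_in_set_iff[symmetric] par_def by auto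
    moreover have "(\<forall>e'\<in>set \<gamma>. (Inl e, e') \<notin> conflict (\<E> \<parallel> \<F>) \<and> (e', Inl e) \<notin> conflict (\<E> \<parallel> \<F>)) \<longleftrightarrow>
        (\<forall>e'\<in>set (lefts \<gamma>). (e, e') \<notin> conflict \<E> \<and> (e', e) \<notin> conflict \<E>)"
      unfolding Ball_def Inl_in_set_iff[symmetric] par_def by auto
    moreover have "Inl e \<in> events (\<E> \<parallel> \<F>) \<longleftrightarrow> e \<in> events \<E>"
      "(Inl e, Inl e) \<in> conflict (\<E> \<parallel> \<F>) \<longleftrightarrow> (e, e) \<in> conflict \<E>"
      by (auto simp: par_def)
    ultimately show ?thesis
      using snoc.IH by (auto simp: Inl traces_snoc Inl_in_set_iff)
  next
    case (Inr e)
    have "(\<forall>y. (y, Inr e) \<in> bundles (\<E> \<parallel> \<F>) \<longrightarrow> (\<exists>e'\<in>set \<gamma>. e' \<in> y)) \<longleftrightarrow>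
        (\<forall>y. (y, e) \<in> bundles \<F> \<longrightarrow> (\<exists>e'\<in>set (rights \<gamma>). e' \<in> y))"
      unfolding ex_Inr_in_set_iff[symmetric] par_def by auto
    moreover have "(\<forall>e'\<in>set \<gamma>. (Inr e, e') \<notin> conflict (\<E> \<parallel> \<F>) \<and> (e', Inr e) \<notin> conflict (\<E> \<parallel> \<F>)) \<longleftrightarrow>
        (\<forall>e'\<in>set (rights \<gamma>). (e, e') \<notin> conflict \<F> \<and> (e', e) \<notin> conflict \<F>)"
      unfolding Ball_def Inr_in_set_iff[symmetric] par_def by auto
    moreover have "Inr e \<in> events (\<E> \<parallel> \<F>) \<longleftrightarrow> e \<in> events \<F>"
      "(Inr e, Inr e) \<in> conflict (\<E> \<parallel> \<F>) \<longleftrightarrow> (e, e) \<in> conflict \<F>"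
      by (auto simp: par_def)
    ultimately show ?thesis
      using snoc.IH by (auto simp: Inr traces_snoc Inr_in_set_iff)
  qed
qed simp

lemma enabled_par:
  assumes "\<gamma> \<in> traces (\<E> \<parallel> \<F>)"
  shows "enabled (\<E> \<parallel> \<F>) \<gamma> = Inl ` enabled \<E> (lefts \<gamma>) \<union> Inr ` enabled \<F> (rights \<gamma>)"
proof (rule set_eqI)
  fix x
  show "x \<in> enabled (\<E> \<parallel> \<F>) \<gamma> \<longleftrightarrow> x \<in> Inl ` enabled \<E> (lefts \<gamma>) \<union> Inr ` enabled \<F> (rights \<gamma>)"
    using assms by (cases x) (auto simp: traces_par_iff)
qed

lemma max_traces_par_iff:
  "\<gamma> \<in> max_traces (\<E> \<parallel> \<F>) \<longleftrightarrow> lefts \<gamma> \<in> max_traces \<E> \<and> rights \<gamma> \<in> max_traces \<F>"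
  by (auto simp: max_traces_iff enabled_par traces_par_iff)

lemma feasible_par:
  assumes "feasible \<E>" "feasible \<F>"
  shows "feasible (\<E> \<parallel> \<F>)"
  unfolding feasible_def
proof
  fix \<gamma>
  assume \<gamma>: "\<gamma> \<in> traces (\<E> \<parallel> \<F>) - max_traces (\<E> \<parallel> \<F>)"
  then consider "lefts \<gamma> \<in> traces \<E> - max_traces \<E>" | "rights \<gamma> \<in> traces \<F> - max_traces \<F>"
    by (auto simp: traces_par_iff max_traces_par_iff)
  then show "(\<Union>e\<in>enabled (\<E> \<parallel> \<F>) \<gamma>. {s. label (\<E> \<parallel> \<F>) e s \<noteq> {}}) = UNIV"
  proof cases
    case 1
    then have "(\<Union>e\<in>enabled \<E> (lefts \<gamma>). {s. label \<E> e s \<noteq> {}}) = UNIV"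
      using assms(1) unfolding feasible_def by blast
    then show ?thesis using \<gamma> by (auto simp: enabled_par simp del: enabled_iff)
  next
    case 2
    then have "(\<Union>e\<in>enabled \<F> (rights \<gamma>). {s. label \<F> e s \<noteq> {}}) = UNIV"
      using assms(2) unfolding feasible_def by blast
    then show ?thesis using \<gamma> by (auto simp: enabled_par simp del: enabled_iff)
  qed
qed

definition well_labelled :: "('e, 's::finite) ipbes \<Rightarrow> bool" where
  "well_labelled \<E> \<longleftrightarrow> (\<forall>e\<in>events \<E>. label \<E> e \<in> H1_bar)"

lemma well_labelled_par: "well_labelled \<E> \<Longrightarrow> well_labelled \<F> \<Longrightarrow> well_labelled (\<E> \<parallel> \<F>)"
  by (auto simp: well_labelled_def par_def)

text \<open>Turns the \<open>has_sum\<close> in the normalisation of a scheduler into a finite sum.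
  For programs it is derived, by \<open>finitely_branching_weak_simulation\<close>.\<close>

definition finitely_branching :: "('e, 's::finite) ipbes \<Rightarrow> bool" where
  "finitely_branching \<E> \<longleftrightarrow> (\<forall>\<alpha>\<in>traces \<E>. finite (enabled \<E> \<alpha>))"

lemma finitely_branching_par:
  "finitely_branching \<E> \<Longrightarrow> finitely_branching \<F> \<Longrightarrow> finitely_branching (\<E> \<parallel> \<F>)"
  unfolding finitely_branching_def by (metis enabled_par finite_UnI finite_imageI traces_par_iff)

subsection \<open>The Kleene star\<close>

definition acts :: "nat \<Rightarrow> star_event list" where
  "acts k = map Act [0..<k]"

lemma acts_0 [simp]: "acts 0 = []"
  by (simp add: acts_def)

lemma acts_Suc: "acts (Suc k) = acts k @ [Act k]"
  by (simp add: acts_def)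

lemma set_acts: "set (acts k) = Act ` {..<k}"
  by (auto simp: acts_def)

lemma acts_inject [simp]: "acts j = acts k \<longleftrightarrow> j = k"
  by (metis acts_def diff_zero length_map length_upt)

lemma events_star [simp]: "events (star r) = UNIV"
  by (simp add: star_def)

lemma label_star [simp]: "label (star r) (Act k) = r" "label (star r) (Done k) = skip"
  by (simp_all add: star_def)

text \<open>Distinctness, or the conflict of \<open>Act j\<close> with \<open>Done j\<close>, forces
  j \<ge> k; the bundle on the predecessor excludes j > k.\<close>

lemma acts_snoc_in_traces_iff:
  assumes "acts k \<in> traces (star r)"
  shows "acts k @ [e] \<in> traces (star r) \<longleftrightarrow> e = Act k \<or> e = Done k"
proof (cases e)
  case (Act j)
  have "acts k @ [Act j] \<in> traces (star r) \<longleftrightarrow> j \<ge> k \<and> (\<forall>i. j = Suc i \<longrightarrow> i < k)"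
    using assms by (auto simp: traces_snoc set_acts star_def)
  then show ?thesis by (cases j) (auto simp: Act)
next
  case (Done j)
  have "acts k @ [Done j] \<in> traces (star r) \<longleftrightarrow> j \<ge> k \<and> (\<forall>i. j = Suc i \<longrightarrow> i < k)"
    using assms by (auto simp: traces_snoc set_acts star_def)
  then show ?thesis by (cases j) (auto simp: Done)
qed

lemma acts_in_traces [simp]: "acts k \<in> traces (star r)"
  by (induction k) (auto simp: acts_Suc acts_snoc_in_traces_iff)

text \<open>A second \<open>Done\<close> conflicts with the first. An \<open>Act j\<close> would
  need j > k, but then its predecessor, of index at least k, has not occurred.\<close>

lemma acts_Done_snoc_not_in_traces: "acts k @ [Done k, e] \<notin> traces (star r)"
proof
  assume "acts k @ [Done k, e] \<in> traces (star r)"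
  then have *: "e \<notin> Act ` {..<k}" "e \<noteq> Done k" "(e, Done k) \<notin> conflict (star r)"
      "\<And>x. (x, e) \<in> bundles (star r) \<Longrightarrow> \<exists>e'\<in>set (acts k @ [Done k]). e' \<in> x"
    using traces_snoc[of "acts k @ [Done k]" e "star r"] by (simp_all add: set_acts)
  show False
  proof (cases e)
    case (Act j)
    have "k < j"
      using *(1,3) by (auto simp: Act star_def linorder_neq_iff)
    then obtain i where i: "j = Suc i" "k \<le> i"
      by (metis Suc_leI Suc_le_D Suc_le_mono)
    then have "({Act i}, e) \<in> bundles (star r)"
      by (simp add: Act star_def)
    from *(4)[OF this] i show False
      by (auto simp: set_acts)
  next
    case (Done j)
    then show False
      using *(2,3) by (simp add: star_def)
  qed
qed

lemma traces_star_iff: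
  "x \<in> traces (star r) \<longleftrightarrow> (\<exists>k. x = acts k \<or> x = acts k @ [Done k])"
proof
  assume "x \<in> traces (star r)"
  then show "\<exists>k. x = acts k \<or> x = acts k @ [Done k]"
  proof (induction rule: traces_induct)
    case Nil
    show ?case by (metis acts_0)
  next
    case (snoc x e)
    then show ?case
      by (auto simp: acts_snoc_in_traces_iff acts_Suc[symmetric] acts_Done_snoc_not_in_traces)
  qed
qed (auto simp: acts_snoc_in_traces_iff)

lemma max_traces_star: "acts k @ [Done k] \<in> max_traces (star r)"
  by (auto simp: max_traces_iff acts_snoc_in_traces_iff acts_Done_snoc_not_in_traces)

text \<open>A single \<open>Done\<close>, labelled \<open>skip\<close>, completes any unfinished
  trace. The maximality clause is thus free for simulations into a star.\<close>

lemma weakly_maximal_star: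
  assumes "x \<in> traces (star r)"
  shows "weakly_maximal (star r) x"
proof -
  from assms consider k where "x = acts k" | k where "x = acts k @ [Done k]"
    by (auto simp: traces_star_iff)
  then show ?thesis
  proof cases
    case 1
    then show ?thesis
      unfolding weakly_maximal_iff by (intro exI[of _ "[Done k]"]) (simp add: max_traces_star prog_le_def)
  next
    case 2
    then show ?thesis
      unfolding weakly_maximal_iff by (intro exI[of _ "[]"]) (simp add: max_traces_star)
  qed
qed

lemma star_nonmax_cases:
  assumes "x \<in> traces (star r)" "x \<notin> max_traces (star r)"
  obtains k where "x = acts k"
  using assms max_traces_star[of _ r] by (auto simp: traces_star_iff)

lemma finitely_branching_star: "finitely_branching (star r)"
  unfolding finitely_branching_def
proof
  fix x
  assume x: "x \<in> traces (star r)"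
  show "finite (enabled (star r) x)"
  proof (cases "x \<in> max_traces (star r)")
    case False
    then obtain k where "x = acts k" using x star_nonmax_cases by blast
    then have "enabled (star r) x \<subseteq> {Act k, Done k}" by (auto simp: acts_snoc_in_traces_iff)
    then show ?thesis by (rule finite_subset) simp
  qed (simp add: max_traces_iff)
qed

lemma feasible_star: "feasible (star r)"
  unfolding feasible_def
proof
  fix x
  assume "x \<in> traces (star r) - max_traces (star r)"
  then obtain k where "x = acts k" using star_nonmax_cases by blast
  then have "Done k \<in> enabled (star r) x" by (simp add: acts_snoc_in_traces_iff)
  moreover have "{s. label (star r) (Done k) s \<noteq> {}} = UNIV" by (simp add: skip_def)
  ultimately show "(\<Union>e\<in>enabled (star r) x. {s. label (star r) e s \<noteq> {}}) = UNIV" by blast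
qed

lemma well_labelled_star:
  assumes "r \<in> H1"
  shows "well_labelled (star r)"
  unfolding well_labelled_def
proof
  fix e
  show "label (star r) e \<in> H1_bar"
    using assms by (cases e) (auto simp: H1_bar_def tests_def skip_def)
qed

section \<open>Simulations\<close>

text \<open>A t-simulation may not stutter on the last event of a maximal trace.  That clause is not
  inherited by composites and is irrelevant to the soundness of simulation, hence this variant.\<close>

definition weak_simulation ::
    "('e, 's::finite) ipbes \<Rightarrow> ('f, 's) ipbes \<Rightarrow> ('e list \<Rightarrow> 'f list) \<Rightarrow> bool" where
  "weak_simulation \<E> \<F> f \<longleftrightarrow>
     f \<in> traces \<E> \<rightarrow> traces \<F> \<and>
     f [] = [] \<and>
     (\<forall>\<beta>\<in>traces \<F>. finite {\<alpha> \<in> traces \<E>. f \<alpha> = \<beta>}) \<and>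
     (\<forall>\<alpha> e. \<alpha> @ [e] \<in> traces \<E> \<longrightarrow>
        (f (\<alpha> @ [e]) = f \<alpha> \<and> label \<E> e \<sqsubseteq>\<^sub>H skip) \<or>
        (\<exists>e'. label \<E> e \<sqsubseteq>\<^sub>H label \<F> e' \<and> f (\<alpha> @ [e]) = f \<alpha> @ [e'])) \<and>
     (\<forall>\<alpha>\<in>max_traces \<E>. weakly_maximal \<F> (f \<alpha>))"

lemma weak_simulationD:
  assumes "weak_simulation \<E> \<F> f"
  shows "\<alpha> \<in> traces \<E> \<Longrightarrow> f \<alpha> \<in> traces \<F>" and "f [] = []"
    and "\<beta> \<in> traces \<F> \<Longrightarrow> finite {\<alpha> \<in> traces \<E>. f \<alpha> = \<beta>}"
    and "\<alpha> \<in> max_traces \<E> \<Longrightarrow> weakly_maximal \<F> (f \<alpha>)"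
  using assms unfolding weak_simulation_def by auto

lemma weak_simulation_snoc:
  assumes "weak_simulation \<E> \<F> f" "\<alpha> @ [e] \<in> traces \<E>"
  obtains (stutter) "f (\<alpha> @ [e]) = f \<alpha>" "label \<E> e \<sqsubseteq>\<^sub>H skip"
    | (step) e' where "label \<E> e \<sqsubseteq>\<^sub>H label \<F> e'" "f (\<alpha> @ [e]) = f \<alpha> @ [e']"
  using assms unfolding weak_simulation_def by blast

lemma prog_le_refl [simp]: "r \<sqsubseteq>\<^sub>H r"
  by (simp add: prog_le_def)

lemma prog_le_trans: "r \<sqsubseteq>\<^sub>H r' \<Longrightarrow> r' \<sqsubseteq>\<^sub>H r'' \<Longrightarrow> r \<sqsubseteq>\<^sub>H r''"
  unfolding prog_le_def by blast

text \<open>In a t-simulation the clause on maximal traces speaks of non-empty ones only; a star as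
  target also settles the case that \<open>[]\<close> is maximal.\<close>

lemma t_simulation_imp_weak:
  assumes "t_simulation \<E> (star r) f"
  shows "weak_simulation \<E> (star r) f"
  using assms unfolding t_simulation_def weak_simulation_def
  by (fast intro: weakly_maximal_star dest: max_tracesD)

lemma weak_simulation_trans_star:
  assumes f: "weak_simulation \<E> \<F> f" and h: "weak_simulation \<F> (star r) h"
  shows "weak_simulation \<E> (star r) (h \<circ> f)"
  unfolding weak_simulation_def
proof (intro conjI ballI allI impI)
  show *: "h \<circ> f \<in> traces \<E> \<rightarrow> traces (star r)"
    using weak_simulationD(1)[OF f] weak_simulationD(1)[OF h] by auto
  show "(h \<circ> f) [] = []"
    using weak_simulationD(2)[OF f] weak_simulationD(2)[OF h] by simp
  show "weakly_maximal (star r) ((h \<circ> f) \<alpha>)" if "\<alpha> \<in> max_traces \<E>" for \<alpha>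
    using * that by (intro weakly_maximal_star) (auto dest: max_tracesD)
next
  fix x assume x: "x \<in> traces (star r)"
  have "{\<alpha> \<in> traces \<E>. (h \<circ> f) \<alpha> = x} \<subseteq>
      (\<Union>\<beta>\<in>{\<beta> \<in> traces \<F>. h \<beta> = x}. {\<alpha> \<in> traces \<E>. f \<alpha> = \<beta>})"
    using weak_simulationD(1)[OF f] by auto
  then show "finite {\<alpha> \<in> traces \<E>. (h \<circ> f) \<alpha> = x}"
    by (rule finite_subset)
       (use weak_simulationD(3)[OF h x] weak_simulationD(3)[OF f] in auto)
next
  fix \<alpha> e assume \<alpha>: "\<alpha> @ [e] \<in> traces \<E>"
  show "(h \<circ> f) (\<alpha> @ [e]) = (h \<circ> f) \<alpha> \<and> label \<E> e \<sqsubseteq>\<^sub>H skip \<or>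
        (\<exists>e'. label \<E> e \<sqsubseteq>\<^sub>H label (star r) e' \<and> (h \<circ> f) (\<alpha> @ [e]) = (h \<circ> f) \<alpha> @ [e'])"
    using f \<alpha>
  proof (cases rule: weak_simulation_snoc)
    case (step e')
    have "f \<alpha> @ [e'] \<in> traces \<F>"
      using weak_simulationD(1)[OF f \<alpha>] step by simp
    with h show ?thesis
      by (cases rule: weak_simulation_snoc) (auto simp: step intro: prog_le_trans[OF step(1)])
  qed simp
qed

lemma weak_simulation_star_mono:
  assumes "r \<sqsubseteq>\<^sub>H r'"
  shows "weak_simulation (star r) (star r') id"
  unfolding weak_simulation_def
proof (intro conjI ballI allI impI disjI2)
  show "id \<in> traces (star r) \<rightarrow> traces (star r')"
    by (simp add: traces_star_iff)
  show "weakly_maximal (star r') (id x)" if "x \<in> max_traces (star r)" for x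
    using max_tracesD[OF that] by (auto intro!: weakly_maximal_star simp: traces_star_iff)
  show "finite {x' \<in> traces (star r). id x' = x}" for x
    by (rule finite_subset[of _ "{x}"]) auto
  show "\<exists>e'. label (star r) e \<sqsubseteq>\<^sub>H label (star r') e' \<and> id (x @ [e]) = id x @ [e']" for x e
    using assms by (cases e) auto
qed simp

text \<open>One-event extensions of \<alpha> are mapped to \<open>f \<alpha>\<close> or to one of
  its finitely many one-event extensions, and each of these has a finite fibre.\<close>

lemma finitely_branching_weak_simulation:
  assumes f: "weak_simulation \<E> \<F> f" and "finitely_branching \<F>"
  shows "finitely_branching \<E>"
  unfolding finitely_branching_def
proof
  fix \<alpha> assume \<alpha>: "\<alpha> \<in> traces \<E>"
  define B where "B = insert (f \<alpha>) ((\<lambda>e'. f \<alpha> @ [e']) ` enabled \<F> (f \<alpha>))"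
  have "finite B"
    using assms(2) weak_simulationD(1)[OF f \<alpha>] by (simp add: B_def finitely_branching_def)
  moreover have B: "B \<subseteq> traces \<F>"
    using weak_simulationD(1)[OF f \<alpha>] by (auto simp: B_def)
  ultimately have "finite (\<Union>\<beta>\<in>B. {\<gamma> \<in> traces \<E>. f \<gamma> = \<beta>})"
    using weak_simulationD(3)[OF f] by blast
  moreover have "(\<lambda>e. \<alpha> @ [e]) ` enabled \<E> \<alpha> \<subseteq> (\<Union>\<beta>\<in>B. {\<gamma> \<in> traces \<E>. f \<gamma> = \<beta>})"
  proof clarsimp
    fix e assume e: "\<alpha> @ [e] \<in> traces \<E>"
    show "f (\<alpha> @ [e]) \<in> B"
      using f e
    proof (cases rule: weak_simulation_snoc)
      case (step e')
      then show ?thesis using weak_simulationD(1)[OF f e] by (simp add: B_def)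
    qed (simp add: B_def)
  qed
  ultimately have "finite ((\<lambda>e. \<alpha> @ [e]) ` enabled \<E> \<alpha>)"
    by (rule finite_subset[rotated])
  then show "finite (enabled \<E> \<alpha>)"
    by (rule finite_imageD) (simp add: inj_on_def)
qed

subsection \<open>Simulating a parallel composition componentwise\<close>

text \<open>Replaces the left component of a trace by its image, leaving the interleaving intact; the
  argument is reversed so that the recursion removes the last event.\<close>

fun sim_left_rev :: "('e list \<Rightarrow> 'f list) \<Rightarrow> ('e + 'c) list \<Rightarrow> ('f + 'c) list" where
  "sim_left_rev f [] = []"
| "sim_left_rev f (Inl a # \<gamma>) = sim_left_rev f \<gamma> @
     map Inl (drop (length (f (lefts (rev \<gamma>)))) (f (lefts (rev \<gamma>) @ [a])))"
| "sim_left_rev f (Inr c # \<gamma>) = sim_left_rev f \<gamma> @ [Inr c]"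

definition sim_left :: "('e list \<Rightarrow> 'f list) \<Rightarrow> ('e + 'c) list \<Rightarrow> ('f + 'c) list" where
  "sim_left f \<gamma> = sim_left_rev f (rev \<gamma>)"

lemma sim_left_simps [simp]:
  "sim_left f [] = []"
  "sim_left f (\<gamma> @ [Inl a]) =
     sim_left f \<gamma> @ map Inl (drop (length (f (lefts \<gamma>))) (f (lefts \<gamma> @ [a])))"
  "sim_left f (\<gamma> @ [Inr c]) = sim_left f \<gamma> @ [Inr c]"
  by (simp_all add: sim_left_def)

text \<open>A step of \<open>f\<close> appends one event or nothing, and \<open>drop\<close>
  extracts exactly this increment.\<close>

lemma lefts_rights_sim_left:
  assumes f: "weak_simulation \<E> \<F> f" and "\<gamma> \<in> traces (\<E> \<parallel> \<G>)"
  shows "lefts (sim_left f \<gamma>) = f (lefts \<gamma>) \<and> rights (sim_left f \<gamma>) = rights \<gamma>"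
  using assms(2)
proof (induction rule: traces_induct)
  case (snoc \<gamma> x)
  show ?case
  proof (cases x)
    case (Inl a)
    then have "lefts \<gamma> @ [a] \<in> traces \<E>"
      using snoc.hyps(1) by (simp add: traces_par_iff)
    with f show ?thesis
      by (cases rule: weak_simulation_snoc) (use snoc.IH in \<open>simp_all add: Inl\<close>)
  next
    case (Inr c)
    then show ?thesis using snoc.IH by simp
  qed
qed (simp add: weak_simulationD(2)[OF f])

lemma weak_simulation_par_left:
  assumes f: "weak_simulation \<E> \<F> f"
  shows "weak_simulation (\<E> \<parallel> \<G>) (\<F> \<parallel> \<G>) (sim_left f)"
  unfolding weak_simulation_def
proof (intro conjI ballI allI impI)
  show "sim_left f \<in> traces (\<E> \<parallel> \<G>) \<rightarrow> traces (\<F> \<parallel> \<G>)"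
  proof
    fix \<gamma> assume "\<gamma> \<in> traces (\<E> \<parallel> \<G>)"
    with lefts_rights_sim_left[OF f this] show "sim_left f \<gamma> \<in> traces (\<F> \<parallel> \<G>)"
      using weak_simulationD(1)[OF f] by (simp add: traces_par_iff)
  qed
next
  fix \<beta> assume "\<beta> \<in> traces (\<F> \<parallel> \<G>)"
  \<comment> \<open>A trace mapped to \<beta> shuffles a member of the fibre of
    \<open>lefts \<beta>\<close> with \<open>rights \<beta>\<close>.\<close>
  then have "finite {\<gamma>. lefts \<gamma> \<in> {\<alpha> \<in> traces \<E>. f \<alpha> = lefts \<beta>} \<and> rights \<gamma> \<in> {rights \<beta>}}"
    using weak_simulationD(3)[OF f] by (intro finite_shuffles) (simp_all add: traces_par_iff)
  then show "finite {\<gamma> \<in> traces (\<E> \<parallel> \<G>). sim_left f \<gamma> = \<beta>}"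
  proof (rule finite_subset[rotated])
    show "{\<gamma> \<in> traces (\<E> \<parallel> \<G>). sim_left f \<gamma> = \<beta>} \<subseteq>
        {\<gamma>. lefts \<gamma> \<in> {\<alpha> \<in> traces \<E>. f \<alpha> = lefts \<beta>} \<and> rights \<gamma> \<in> {rights \<beta>}}"
    proof clarify
      fix \<gamma> assume "\<gamma> \<in> traces (\<E> \<parallel> \<G>)"
      with lefts_rights_sim_left[OF f this]
      show "lefts \<gamma> \<in> {\<alpha> \<in> traces \<E>. f \<alpha> = lefts (sim_left f \<gamma>)} \<and> rights \<gamma> \<in> {rights (sim_left f \<gamma>)}"
        by (simp add: traces_par_iff)
    qed
  qed
next
  fix \<gamma> x assume \<gamma>: "\<gamma> @ [x] \<in> traces (\<E> \<parallel> \<G>)"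
  show "sim_left f (\<gamma> @ [x]) = sim_left f \<gamma> \<and> label (\<E> \<parallel> \<G>) x \<sqsubseteq>\<^sub>H skip \<or>
      (\<exists>e'. label (\<E> \<parallel> \<G>) x \<sqsubseteq>\<^sub>H label (\<F> \<parallel> \<G>) e' \<and> sim_left f (\<gamma> @ [x]) = sim_left f \<gamma> @ [e'])"
  proof (cases x)
    case (Inl a)
    then have "lefts \<gamma> @ [a] \<in> traces \<E>"
      using \<gamma> by (simp add: traces_par_iff)
    with f show ?thesis
    proof (cases rule: weak_simulation_snoc)
      case (step e')
      then show ?thesis by (intro disjI2 exI[of _ "Inl e'"]) (simp add: Inl)
    qed (simp add: Inl)
  next
    case (Inr c)
    then show ?thesis by (intro disjI2 exI[of _ "Inr c"]) simp
  qed
next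
  fix \<gamma> assume \<gamma>: "\<gamma> \<in> max_traces (\<E> \<parallel> \<G>)"
  then have "weakly_maximal \<F> (f (lefts \<gamma>))"
    using weak_simulationD(4)[OF f] by (simp add: max_traces_par_iff)
  then obtain es where es: "f (lefts \<gamma>) @ es \<in> max_traces \<F>" "\<forall>e\<in>set es. skip \<sqsubseteq>\<^sub>H label \<F> e"
    by (auto simp: weakly_maximal_iff)
  \<comment> \<open>The right component is already maximal, so completing the left one completes the
    whole trace.\<close>
  then show "weakly_maximal (\<F> \<parallel> \<G>) (sim_left f \<gamma>)"
    unfolding weakly_maximal_iff using \<gamma> lefts_rights_sim_left[OF f max_tracesD[OF \<gamma>]]
    by (intro exI[of _ "map Inl es"]) (auto simp: max_traces_par_iff)
qed simp

text \<open>Simulations are lifted through the left operand only. Exchanging the last two components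
  lets either program stand next to the star and be merged with it.\<close>

fun par_swap :: "('a + 'b) + 'c \<Rightarrow> ('a + 'c) + 'b" where
  "par_swap (Inl (Inl a)) = Inl (Inl a)"
| "par_swap (Inl (Inr b)) = Inr b"
| "par_swap (Inr c) = Inl (Inr c)"

lemma inj_par_swap: "inj par_swap"
proof (rule injI)
  fix x y :: "('a + 'b) + 'c"
  assume "par_swap x = par_swap y"
  then show "x = y" by (cases x rule: par_swap.cases; cases y rule: par_swap.cases) auto
qed

lemma lefts_rights_map_par_swap [simp]:
  "lefts (lefts (map par_swap \<gamma>)) = lefts (lefts \<gamma>)"
  "rights (lefts (map par_swap \<gamma>)) = rights \<gamma>"
  "rights (map par_swap \<gamma>) = rights (lefts \<gamma>)"
proof (induction \<gamma>)
  case (Cons x \<gamma>)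
  {
    case 1 show ?case using Cons.IH by (cases x rule: par_swap.cases) auto
  next
    case 2 show ?case using Cons.IH by (cases x rule: par_swap.cases) auto
  next
    case 3 show ?case using Cons.IH by (cases x rule: par_swap.cases) auto
  }
qed simp_all

lemma weak_simulation_par_swap:
  "weak_simulation (\<E> \<parallel> \<F> \<parallel> \<G>) (\<E> \<parallel> \<G> \<parallel> \<F>) (map par_swap)"
  unfolding weak_simulation_def
proof (intro conjI ballI allI impI disjI2)
  show "map par_swap \<in> traces (\<E> \<parallel> \<F> \<parallel> \<G>) \<rightarrow> traces (\<E> \<parallel> \<G> \<parallel> \<F>)"
    by (auto simp: traces_par_iff)
  show "weakly_maximal (\<E> \<parallel> \<G> \<parallel> \<F>) (map par_swap \<gamma>)" if "\<gamma> \<in> max_traces (\<E> \<parallel> \<F> \<parallel> \<G>)" for \<gamma>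
    unfolding weakly_maximal_iff using that by (intro exI[of _ "[]"]) (simp add: max_traces_par_iff)
  show "finite {\<gamma> \<in> traces (\<E> \<parallel> \<F> \<parallel> \<G>). map par_swap \<gamma> = \<beta>}" for \<beta>
  proof (rule finite_subset)
    show "finite (map par_swap -` {\<beta>})"
      by (rule finite_vimageI) (use inj_par_swap in auto)
  qed auto
  show "\<exists>e'. label (\<E> \<parallel> \<F> \<parallel> \<G>) x \<sqsubseteq>\<^sub>H label (\<E> \<parallel> \<G> \<parallel> \<F>) e' \<and>
      map par_swap (\<gamma> @ [x]) = map par_swap \<gamma> @ [e']" for \<gamma> x
    by (intro exI[of _ "par_swap x"]) (cases x rule: par_swap.cases; simp)
qed simp

subsection \<open>Merging two simulations into Kleene stars\<close>

definition act_count :: "star_event list \<Rightarrow> nat" where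
  "act_count x = length (filter (\<lambda>e. \<exists>k. e = Act k) x)"

lemma act_count_acts [simp]: "act_count (acts k) = k"
  by (induction k) (auto simp: act_count_def acts_Suc)

lemma act_count_simps [simp]:
  "act_count [] = 0"
  "act_count (x @ [Act k]) = Suc (act_count x)" "act_count (x @ [Done k]) = act_count x"
  by (auto simp: act_count_def)

lemma finite_act_count_eq: "finite {x \<in> traces (star r). act_count x \<le> k}"
proof (rule finite_subset)
  show "{x \<in> traces (star r). act_count x \<le> k} \<subseteq> (\<Union>j\<le>k. {acts j, acts j @ [Done j]})"
    by (auto simp: traces_star_iff)
qed simp

definition exited :: "star_event list \<Rightarrow> bool" where
  "exited x \<longleftrightarrow> (\<exists>k. Done k \<in> set x)"

lemma exited_simps [simp]:
  "\<not> exited []" "exited (x @ [Act k]) \<longleftrightarrow> exited x" "exited (x @ [Done k])"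
  by (auto simp: exited_def)

lemma exited_snoc_not_in_traces:
  assumes "exited x"
  shows "x @ [e] \<notin> traces (star r)"
proof
  assume *: "x @ [e] \<in> traces (star r)"
  then obtain k where "x = acts k"
    using star_nonmax_cases[OF traces_snocD snoc_not_max] by blast
  with assms show False
    by (auto simp: exited_def set_acts)
qed

text \<open>A component leaving its loop must be hidden while the other one is running; it is shown only if
  it ends a maximal trace, where a t-simulation may not stutter.\<close>

definition merge ::
    "('e + 'f) list set \<Rightarrow> ('e list \<Rightarrow> star_event list) \<Rightarrow> ('f list \<Rightarrow> star_event list) \<Rightarrow>
     ('e + 'f) list \<Rightarrow> star_event list" where
  "merge M f h \<gamma> =
     (let k = act_count (f (lefts \<gamma>)) + act_count (h (rights \<gamma>)) in
      if \<gamma> \<in> M \<and> \<gamma> \<noteq> [] \<and>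
         (case last \<gamma> of Inl _ \<Rightarrow> exited (f (lefts \<gamma>)) | Inr _ \<Rightarrow> exited (h (rights \<gamma>)))
      then acts k @ [Done k] else acts k)"

text \<open>Weight 0 or 1 discards one operand, but an element of it must still be supplied; members
  of \<open>H1\<close> have non-empty values.\<close>

lemma prog_le_choice:
  assumes "g \<in> H1" "g' \<in> H1"
  shows "g \<sqsubseteq>\<^sub>H choice g g'" "g' \<sqsubseteq>\<^sub>H choice g g'"
proof -
  show "g \<sqsubseteq>\<^sub>H choice g g'"
    unfolding prog_le_def
  proof (intro allI subsetI)
    fix s \<mu> assume \<mu>: "\<mu> \<in> g s"
    obtain \<mu>' where "\<mu>' \<in> g' s" using assms(2) unfolding H1_def by blast
    with \<mu> show "\<mu> \<in> choice g g' s"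
      unfolding choice_def by (intro CollectI exI[of _ 0] exI[of _ \<mu>] exI[of _ \<mu>']) simp
  qed
  show "g' \<sqsubseteq>\<^sub>H choice g g'"
    unfolding prog_le_def
  proof (intro allI subsetI)
    fix s \<mu>' assume \<mu>': "\<mu>' \<in> g' s"
    obtain \<mu> where "\<mu> \<in> g s" using assms(1) unfolding H1_def by blast
    with \<mu>' show "\<mu>' \<in> choice g g' s"
      unfolding choice_def by (intro CollectI exI[of _ 1] exI[of _ \<mu>] exI[of _ \<mu>']) simp
  qed
qed

text \<open>Convexity of the values. It identifies the target of two merged simulations into the
  star of \<open>r\<close> with that star.\<close>

lemma choice_self:
  assumes "r \<in> H1"
  shows "choice r r = r"
proof -
  have "choice r r s \<subseteq> r s" for s
  proof -
    have "convex (r s)"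
      using assms unfolding H1_def by blast
    then have "(1 - p) *\<^sub>R \<mu> + p *\<^sub>R \<mu>' \<in> r s" if "p \<in> {0..1}" "\<mu> \<in> r s" "\<mu>' \<in> r s" for p \<mu> \<mu>'
      using that convexD_alt[of "r s" \<mu> \<mu>' p] by simp
    then show ?thesis
      unfolding choice_def by blast
  qed
  then show ?thesis
    using prog_le_choice(1)[OF assms assms] unfolding prog_le_def by blast
qed

context
  fixes \<E> :: "('e, 's::finite) ipbes" and \<F> :: "('f, 's) ipbes" and g g' f h
  assumes f: "weak_simulation \<E> (star g) f" and h: "weak_simulation \<F> (star g') h"
    and g: "g \<in> H1" and g': "g' \<in> H1"
begin

private abbreviation "mg \<equiv> merge (max_traces (\<E> \<parallel> \<F>)) f h"
private abbreviation "cnt \<gamma> \<equiv> act_count (f (lefts \<gamma>)) + act_count (h (rights \<gamma>))"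

private lemma merge_nonmax: "\<gamma> \<notin> max_traces (\<E> \<parallel> \<F>) \<Longrightarrow> mg \<gamma> = acts (cnt \<gamma>)"
  by (simp add: merge_def)

private lemma merge_cases: "mg \<gamma> = acts (cnt \<gamma>) \<or> mg \<gamma> = acts (cnt \<gamma>) @ [Done (cnt \<gamma>)]"
  by (simp add: merge_def Let_def)

text \<open>Before its last event the trace is not maximal, so its image is a plain run of loop
  bodies. The new event adds a body or is below \<open>skip\<close>.\<close>

private lemma merge_step_Inl:
  assumes \<gamma>: "\<gamma> @ [Inl e] \<in> traces (\<E> \<parallel> \<F>)"
  shows "(mg (\<gamma> @ [Inl e]) = mg \<gamma> \<and> label \<E> e \<sqsubseteq>\<^sub>H skip) \<or>
     (\<exists>e'. label \<E> e \<sqsubseteq>\<^sub>H label (star (choice g g')) e' \<and> mg (\<gamma> @ [Inl e]) = mg \<gamma> @ [e'])"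
proof -
  have *: "mg \<gamma> = acts (cnt \<gamma>)"
    by (rule merge_nonmax[OF snoc_not_max[OF \<gamma>]])
  have e: "lefts \<gamma> @ [e] \<in> traces \<E>"
    using \<gamma> by (simp add: traces_par_iff)
  \<comment> \<open>If \<open>merge\<close> shows such an event at all, it shows it as a
    \<open>Done\<close>, whose label \<open>skip\<close> admits it.\<close>
  have stutter: ?thesis if "cnt (\<gamma> @ [Inl e]) = cnt \<gamma>" "label \<E> e \<sqsubseteq>\<^sub>H skip"
    using merge_cases[of "\<gamma> @ [Inl e]"]
  proof
    assume "mg (\<gamma> @ [Inl e]) = acts (cnt (\<gamma> @ [Inl e])) @ [Done (cnt (\<gamma> @ [Inl e]))]"
    then show ?thesis using that * by (intro disjI2 exI[of _ "Done (cnt \<gamma>)"]) simp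
  qed (use that * in simp)
  show ?thesis
    using f e
  proof (cases rule: weak_simulation_snoc)
    case (step e')
    show ?thesis
    proof (cases e')
      case (Act k)
      \<comment> \<open>The image could still be extended by \<open>Act k\<close>, so it has not
        exited and \<open>merge\<close> adds no \<open>Done\<close>.\<close>
      have "\<not> exited (f (lefts \<gamma>))"
        using exited_snoc_not_in_traces weak_simulationD(1)[OF f e] step by metis
      then have "mg (\<gamma> @ [Inl e]) = mg \<gamma> @ [Act (cnt \<gamma>)]"
        using * by (simp add: merge_def step Act acts_Suc)
      then show ?thesis
        using step(1) prog_le_trans[OF _ prog_le_choice(1)[OF g g']]
        by (intro disjI2 exI[of _ "Act (cnt \<gamma>)"]) (simp add: Act)
    next
      case (Done k)
      then show ?thesis using step by (intro stutter) simp_all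
    qed
  qed (use stutter in simp)
qed

private lemma merge_step_Inr:
  assumes \<gamma>: "\<gamma> @ [Inr e] \<in> traces (\<E> \<parallel> \<F>)"
  shows "(mg (\<gamma> @ [Inr e]) = mg \<gamma> \<and> label \<F> e \<sqsubseteq>\<^sub>H skip) \<or>
     (\<exists>e'. label \<F> e \<sqsubseteq>\<^sub>H label (star (choice g g')) e' \<and> mg (\<gamma> @ [Inr e]) = mg \<gamma> @ [e'])"
proof -
  have *: "mg \<gamma> = acts (cnt \<gamma>)"
    by (rule merge_nonmax[OF snoc_not_max[OF \<gamma>]])
  have e: "rights \<gamma> @ [e] \<in> traces \<F>"
    using \<gamma> by (simp add: traces_par_iff)
  have stutter: ?thesis if "cnt (\<gamma> @ [Inr e]) = cnt \<gamma>" "label \<F> e \<sqsubseteq>\<^sub>H skip"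
    using merge_cases[of "\<gamma> @ [Inr e]"]
  proof
    assume "mg (\<gamma> @ [Inr e]) = acts (cnt (\<gamma> @ [Inr e])) @ [Done (cnt (\<gamma> @ [Inr e]))]"
    then show ?thesis using that * by (intro disjI2 exI[of _ "Done (cnt \<gamma>)"]) simp
  qed (use that * in simp)
  show ?thesis
    using h e
  proof (cases rule: weak_simulation_snoc)
    case (step e')
    show ?thesis
    proof (cases e')
      case (Act k)
      have "\<not> exited (h (rights \<gamma>))"
        using exited_snoc_not_in_traces weak_simulationD(1)[OF h e] step by metis
      then have "mg (\<gamma> @ [Inr e]) = mg \<gamma> @ [Act (cnt \<gamma>)]"
        using * by (simp add: merge_def step Act acts_Suc)
      then show ?thesis
        using step(1) prog_le_trans[OF _ prog_le_choice(2)[OF g g']]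
        by (intro disjI2 exI[of _ "Act (cnt \<gamma>)"]) (simp add: Act)
    next
      case (Done k)
      then show ?thesis using step by (intro stutter) simp_all
    qed
  qed (use stutter in simp)
qed

lemma weak_simulation_merge:
  "weak_simulation (\<E> \<parallel> \<F>) (star (choice g g')) (merge (max_traces (\<E> \<parallel> \<F>)) f h)"
  unfolding weak_simulation_def
proof (intro conjI ballI allI impI)
  show *: "mg \<in> traces (\<E> \<parallel> \<F>) \<rightarrow> traces (star (choice g g'))"
    using merge_cases by (fastforce simp: traces_star_iff)
  show "weakly_maximal (star (choice g g')) (mg \<gamma>)" if "\<gamma> \<in> max_traces (\<E> \<parallel> \<F>)" for \<gamma>
    using * that by (intro weakly_maximal_star) (auto dest: max_tracesD)
  show "mg [] = []"
    by (simp add: merge_def weak_simulationD(2)[OF f] weak_simulationD(2)[OF h])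
next
  fix x
  \<comment> \<open>The count of each component is at most that of the merged image; a star has
    finitely many traces of bounded count, and their fibres are finite.\<close>
  have fin: "finite {\<alpha> \<in> traces \<D>. act_count (u \<alpha>) \<le> k}"
    if "weak_simulation \<D> (star r) u" for \<D> :: "('d, 's) ipbes" and r u k
  proof (rule finite_subset)
    show "{\<alpha> \<in> traces \<D>. act_count (u \<alpha>) \<le> k} \<subseteq>
        (\<Union>x\<in>{x \<in> traces (star r). act_count x \<le> k}. {\<alpha> \<in> traces \<D>. u \<alpha> = x})"
      using weak_simulationD(1)[OF that] by auto
  qed (use weak_simulationD(3)[OF that] finite_act_count_eq in auto)
  show "finite {\<gamma> \<in> traces (\<E> \<parallel> \<F>). mg \<gamma> = x}"
  proof (rule finite_subset)
    show "finite {\<gamma>. lefts \<gamma> \<in> {\<alpha> \<in> traces \<E>. act_count (f \<alpha>) \<le> act_count x} \<and>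
        rights \<gamma> \<in> {\<beta> \<in> traces \<F>. act_count (h \<beta>) \<le> act_count x}}"
      by (intro finite_shuffles fin[OF f] fin[OF h])
    have "cnt \<gamma> = act_count (mg \<gamma>)" for \<gamma>
      using merge_cases[of \<gamma>] by auto
    then show "{\<gamma> \<in> traces (\<E> \<parallel> \<F>). mg \<gamma> = x} \<subseteq>
        {\<gamma>. lefts \<gamma> \<in> {\<alpha> \<in> traces \<E>. act_count (f \<alpha>) \<le> act_count x} \<and>
        rights \<gamma> \<in> {\<beta> \<in> traces \<F>. act_count (h \<beta>) \<le> act_count x}}"
      by (smt (verit) Collect_mono le_add1 le_add2 mem_Collect_eq traces_par_iff)
  qed
next
  fix \<gamma> x assume \<gamma>: "\<gamma> @ [x] \<in> traces (\<E> \<parallel> \<F>)"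
  show "mg (\<gamma> @ [x]) = mg \<gamma> \<and> label (\<E> \<parallel> \<F>) x \<sqsubseteq>\<^sub>H skip \<or>
      (\<exists>e'. label (\<E> \<parallel> \<F>) x \<sqsubseteq>\<^sub>H label (star (choice g g')) e' \<and> mg (\<gamma> @ [x]) = mg \<gamma> @ [e'])"
    using merge_step_Inl merge_step_Inr \<gamma> by (cases x) simp_all
qed

end

text \<open>The last event of a maximal trace also ends a maximal trace of its own component, whose
  t-simulation must show an event there. An \<open>Act\<close> raises the count, and a
  \<open>Done\<close> is what \<open>merge\<close> makes visible in this case.\<close>

lemma t_simulation_merge:
  assumes f: "t_simulation \<E> (star g) f" and h: "t_simulation \<F> (star g') h"
    and g: "g \<in> H1" and g': "g' \<in> H1"
  shows "t_simulation (\<E> \<parallel> \<F>) (star (choice g g')) (merge (max_traces (\<E> \<parallel> \<F>)) f h)"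
proof -
  let ?m = "merge (max_traces (\<E> \<parallel> \<F>)) f h"
  have w: "weak_simulation (\<E> \<parallel> \<F>) (star (choice g g')) ?m"
    by (intro weak_simulation_merge t_simulation_imp_weak f h g g')
  have last: "?m (\<gamma> @ [x]) \<noteq> ?m \<gamma>" if \<gamma>: "\<gamma> @ [x] \<in> max_traces (\<E> \<parallel> \<F>)" for \<gamma> x
  proof -
    have *: "?m \<gamma> = acts (act_count (f (lefts \<gamma>)) + act_count (h (rights \<gamma>)))"
      using snoc_not_max[OF max_tracesD[OF \<gamma>]] by (simp add: merge_def)
    show ?thesis
    proof (cases x)
      case (Inl e)
      then have "lefts \<gamma> @ [e] \<in> max_traces \<E>"
        using \<gamma> by (simp add: max_traces_par_iff)
      then obtain e' where "f (lefts \<gamma> @ [e]) = f (lefts \<gamma>) @ [e']"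
        using f unfolding t_simulation_def by blast
      then show ?thesis
        using * \<gamma> by (cases e') (auto simp: merge_def Inl Let_def dest: arg_cong[of _ _ act_count])
    next
      case (Inr e)
      then have "rights \<gamma> @ [e] \<in> max_traces \<F>"
        using \<gamma> by (simp add: max_traces_par_iff)
      then obtain e' where "h (rights \<gamma> @ [e]) = h (rights \<gamma>) @ [e']"
        using h unfolding t_simulation_def by blast
      then show ?thesis
        using * \<gamma> by (cases e') (auto simp: merge_def Inr Let_def dest: arg_cong[of _ _ act_count])
    qed
  qed
  show ?thesis
    unfolding t_simulation_def
  proof (intro conjI ballI allI impI)
    show "?m \<in> traces (\<E> \<parallel> \<F>) \<rightarrow> traces (star (choice g g'))" "?m [] = []"
      using weak_simulationD[OF w] by auto
    show "finite {\<gamma> \<in> traces (\<E> \<parallel> \<F>). ?m \<gamma> = x}" if "x \<in> traces (star (choice g g'))" for x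
      using weak_simulationD(3)[OF w that] .
    show "(?m (\<gamma> @ [x]) = ?m \<gamma> \<and> label (\<E> \<parallel> \<F>) x \<sqsubseteq>\<^sub>H skip) \<or>
        (\<exists>e'\<in>events (star (choice g g')). label (\<E> \<parallel> \<F>) x \<sqsubseteq>\<^sub>H label (star (choice g g')) e' \<and>
           ?m (\<gamma> @ [x]) = ?m \<gamma> @ [e'])" if "\<gamma> @ [x] \<in> traces (\<E> \<parallel> \<F>)" for \<gamma> x
      using w that by (cases rule: weak_simulation_snoc) auto
    show "weakly_maximal (star (choice g g')) (?m (\<gamma> @ [x]))"
      if "\<gamma> @ [x] \<in> max_traces (\<E> \<parallel> \<F>)" for \<gamma> x
      using weak_simulationD(4)[OF w that] .
    show "\<exists>e'\<in>events (star (choice g g')). label (\<E> \<parallel> \<F>) x \<sqsubseteq>\<^sub>H label (star (choice g g')) e' \<and>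
        ?m (\<gamma> @ [x]) = ?m \<gamma> @ [e']" if "\<gamma> @ [x] \<in> max_traces (\<E> \<parallel> \<F>)" for \<gamma> x
      using w max_tracesD[OF that]
      by (cases rule: weak_simulation_snoc) (use last[OF that] in auto)
  qed
qed

section \<open>Schedulers and flows\<close>

lemma bounded_linear_mass: "bounded_linear (\<lambda>v. mass v S)"
  unfolding mass_def by (intro bounded_linear_sum bounded_linear_vec_nth)

lemma mass_sum: "mass (\<Sum>i\<in>I. v i) S = (\<Sum>i\<in>I. mass (v i) S)"
  using linear_sum[OF bounded_linear.linear[OF bounded_linear_mass]] .

lemma mass_scaleR [simp]: "mass (c *\<^sub>R v) S = c * mass v S"
  using linear_scale[OF bounded_linear.linear[OF bounded_linear_mass]] by simp

lemma mass_0 [simp]: "mass 0 S = 0"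
  by (simp add: mass_def)

lemma mass_nonneg: "(\<And>s. 0 \<le> v $ s) \<Longrightarrow> 0 \<le> mass v S"
  by (simp add: mass_def sum_nonneg)

lemma mass_point [simp]: "mass (point s) UNIV = 1"
  by (simp add: mass_def point_def axis_def)

lemma mass_UNIV_eq_0_iff: "(\<And>s. 0 \<le> v $ s) \<Longrightarrow> mass v UNIV = 0 \<longleftrightarrow> v = 0"
  by (simp add: mass_def sum_nonneg_eq_0_iff vec_eq_iff)

lemma point_nth: "point s $ u = (if u = s then 1 else 0)"
  by (simp add: point_def axis_def)

lemma point_in_distributions: "point s \<in> distributions"
  by (simp add: distributions_def point_nth)

lemma sum_point_eq: "(\<Sum>t\<in>UNIV. (v $ t) *\<^sub>R point t) = (v :: real ^ 's::finite)"
  by (simp add: vec_eq_iff point_nth if_distrib cong: if_cong)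

lemma distributions_mass: "\<mu> \<in> distributions \<Longrightarrow> mass \<mu> UNIV = 1"
  by (simp add: distributions_def mass_def)

lemma distributions_nonneg: "\<mu> \<in> distributions \<Longrightarrow> 0 \<le> \<mu> $ s"
  by (simp add: distributions_def)

lemma in_distributionsI: "(\<And>s. 0 \<le> \<mu> $ s) \<Longrightarrow> mass \<mu> UNIV = 1 \<Longrightarrow> \<mu> \<in> distributions"
  by (simp add: distributions_def mass_def)

lemma label_distributions:
  assumes "well_labelled \<E>" "\<alpha> @ [e] \<in> traces \<E>"
  shows "label \<E> e s \<subseteq> distributions"
proof -
  have "label \<E> e \<in> H1_bar"
    using assms by (simp add: well_labelled_def traces_snoc)
  then show ?thesis
    using point_in_distributions unfolding H1_bar_def H1_def tests_def by blast
qed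

lemma label_mass:
  assumes "well_labelled \<E>" "\<alpha> @ [e] \<in> traces \<E>" "\<mu> \<in> label \<E> e s"
  shows "mass \<mu> UNIV = 1"
  using label_distributions[OF assms(1,2)] assms(3) by (blast intro: distributions_mass)

lemma label_convex:
  assumes "well_labelled \<E>" "\<alpha> @ [e] \<in> traces \<E>"
  shows "convex (label \<E> e s)"
proof -
  have "label \<E> e \<in> H1_bar"
    using assms by (simp add: well_labelled_def traces_snoc)
  moreover have "convex A" if "A \<subseteq> {point s}" for A
    using that by (metis convex_empty convex_singleton subset_singletonD)
  ultimately show ?thesis
    unfolding H1_bar_def H1_def tests_def by blast
qed

text \<open>The cone over \<open>L\<close>, with its apex present even if \<open>L\<close> is empty.
  It covers both kinds of scheduler values: a weighted distribution, and the 0 forced by an empty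
  label.\<close>

definition scaled :: "(real ^ 's::finite) set \<Rightarrow> (real ^ 's) set" where
  "scaled L = insert 0 {c *\<^sub>R \<mu> | c \<mu>. 0 < c \<and> \<mu> \<in> L}"

lemma zero_in_scaled [simp]: "0 \<in> scaled L"
  by (simp add: scaled_def)

lemma scaled_mono: "L \<subseteq> L' \<Longrightarrow> scaled L \<subseteq> scaled L'"
  unfolding scaled_def by blast

lemma scaleR_in_scaled:
  assumes "0 \<le> c" "v \<in> scaled L"
  shows "c *\<^sub>R v \<in> scaled L"
proof (cases "c = 0 \<or> v = 0")
  case False
  then obtain d \<mu> where "v = d *\<^sub>R \<mu>" "0 < d" "\<mu> \<in> L"
    using assms(2) by (auto simp: scaled_def)
  then have "c *\<^sub>R v = (c * d) *\<^sub>R \<mu>" "0 < c * d" "\<mu> \<in> L"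
    using False assms(1) by auto
  then show ?thesis unfolding scaled_def by blast
qed auto

lemma subset_scaled: "L \<subseteq> scaled L"
  unfolding scaled_def using scaleR_one zero_less_one by (metis (mono_tags, lifting) CollectI insertCI subsetI)

text \<open>Two rays add up to \<open>c + c'\<close> times a convex combination of their base
  points. This is what lets flows through a fibre be added.\<close>

lemma scaled_add:
  assumes "convex L" "v \<in> scaled L" "v' \<in> scaled L"
  shows "v + v' \<in> scaled L"
proof (cases "v = 0 \<or> v' = 0")
  case False
  with assms obtain c \<mu> c' \<mu>' where v: "v = c *\<^sub>R \<mu>" "0 < c" "\<mu> \<in> L" "v' = c' *\<^sub>R \<mu>'" "0 < c'" "\<mu>' \<in> L"
    by (auto simp: scaled_def)
  have "(c / (c + c')) *\<^sub>R \<mu> + (c' / (c + c')) *\<^sub>R \<mu>' \<in> L"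
    using v by (intro convexD[OF assms(1)]) (simp_all add: add_divide_distrib[symmetric])
  moreover have "v + v' = (c + c') *\<^sub>R ((c / (c + c')) *\<^sub>R \<mu> + (c' / (c + c')) *\<^sub>R \<mu>')"
    using v by (simp add: scaleR_add_right)
  ultimately show ?thesis
    using v(2,5) add_pos_pos unfolding scaled_def by blast
qed (use assms in auto)

lemma scaled_sum:
  assumes "convex L" "\<And>i. i \<in> I \<Longrightarrow> v i \<in> scaled L"
  shows "(\<Sum>i\<in>I. v i) \<in> scaled L"
  using assms(2) by (induction I rule: infinite_finite_induct) (auto intro: scaled_add[OF assms(1)])

lemma scaled_nonneg:
  assumes "L \<subseteq> distributions" "v \<in> scaled L"
  shows "0 \<le> v $ s"
proof (cases "v = 0")
  case False
  then obtain c \<mu> where "v = c *\<^sub>R \<mu>" "0 < c" "\<mu> \<in> L"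
    using assms(2) by (auto simp: scaled_def)
  then show ?thesis
    using assms(1) distributions_nonneg[of \<mu> s] by auto
qed simp

text \<open>Base points have mass 1, so the scaling factor is the mass. For v = 0 any element of
  \<open>L\<close> serves.\<close>

lemma scaled_conv_mass:
  assumes "L \<subseteq> distributions" "v \<in> scaled L" "L \<noteq> {}"
  shows "\<exists>\<mu>\<in>L. v = mass v UNIV *\<^sub>R \<mu>"
proof (cases "v = 0")
  case False
  then obtain c \<mu> where "v = c *\<^sub>R \<mu>" "\<mu> \<in> L" using assms(2) by (auto simp: scaled_def)
  moreover from this have "mass v UNIV = c"
    using assms(1) distributions_mass by (metis mass_scaleR mult.right_neutral subsetD)
  ultimately show ?thesis by metis
qed (use assms(3) in auto)

lemma scaled_point:
  assumes "v \<in> scaled {point t}"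
  shows "v = mass v UNIV *\<^sub>R point t"
  using scaled_conv_mass[OF _ assms] point_in_distributions by auto

subsection \<open>Weights of a scheduler\<close>

text \<open>The existentially quantified weight is recovered as the mass of the scheduled vector, so
  that conditions on vectors alone remain.\<close>

lemma scheduler_imp_weights:
  assumes \<sigma>: "scheduler \<E> \<sigma>" and wl: "well_labelled \<E>" and fb: "finitely_branching \<E>"
  shows "\<alpha> @ [e] \<in> traces \<E> \<Longrightarrow> the (\<sigma> \<alpha> (e, t)) \<in> scaled (label \<E> e t)"
    and "\<alpha> \<in> traces \<E> - max_traces \<E> \<Longrightarrow> (\<Sum>e\<in>enabled \<E> \<alpha>. mass (the (\<sigma> \<alpha> (e, t))) UNIV) = 1"
proof -
  have *: "\<exists>w :: 'a \<times> 'b \<Rightarrow> real. (\<forall>e\<in>enabled \<E> \<alpha>. \<forall>t. the (\<sigma> \<alpha> (e, t)) \<in> scaled (label \<E> e t) \<and>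
          mass (the (\<sigma> \<alpha> (e, t))) UNIV = w (e, t)) \<and>
        (enabled \<E> \<alpha> \<noteq> {} \<longrightarrow> (\<forall>t. (\<Sum>e\<in>enabled \<E> \<alpha>. w (e, t)) = 1))"
    if \<alpha>: "\<alpha> \<in> traces \<E>" for \<alpha>
  proof -
    obtain w :: "'a \<times> 'b \<Rightarrow> real" where w:
      "\<forall>e\<in>events \<E>. \<forall>s. w (e, s) \<in> {0..1}"
      "\<forall>e\<in>enabled \<E> \<alpha>. \<forall>s. (label \<E> e s \<noteq> {} \<longrightarrow>
              (\<exists>\<mu>\<in>label \<E> e s. \<sigma> \<alpha> (e, s) = Some (w (e, s) *\<^sub>R \<mu>))) \<and>
           (label \<E> e s = {} \<longrightarrow> w (e, s) = 0 \<and> \<sigma> \<alpha> (e, s) = Some 0)"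
      "enabled \<E> \<alpha> \<noteq> {} \<longrightarrow> (\<forall>s. ((\<lambda>e. w (e, s)) has_sum 1) (enabled \<E> \<alpha>))"
      using \<sigma> \<alpha> unfolding scheduler_def by blast
    have "the (\<sigma> \<alpha> (e, t)) \<in> scaled (label \<E> e t) \<and> mass (the (\<sigma> \<alpha> (e, t))) UNIV = w (e, t)"
      if e: "e \<in> enabled \<E> \<alpha>" for e t
    proof (cases "label \<E> e t = {}")
      case True
      then show ?thesis using w(2) e by auto
    next
      case False
      then obtain \<mu> where \<mu>: "\<mu> \<in> label \<E> e t" "\<sigma> \<alpha> (e, t) = Some (w (e, t) *\<^sub>R \<mu>)"
        using w(2) e by blast
      have "0 \<le> w (e, t)"
        using w(1) e by (simp add: traces_snoc)
      moreover have "mass \<mu> UNIV = 1"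
        using label_mass[OF wl] e \<mu>(1) by simp
      ultimately show ?thesis
        using \<mu> subset_scaled by (auto intro!: scaleR_in_scaled)
    qed
    moreover have "(\<Sum>e\<in>enabled \<E> \<alpha>. w (e, t)) = 1" if "enabled \<E> \<alpha> \<noteq> {}" for t
      using w(3) that fb \<alpha> has_sum_finite has_sum_unique unfolding finitely_branching_def by metis
    ultimately show ?thesis by blast
  qed
  show "the (\<sigma> \<alpha> (e, t)) \<in> scaled (label \<E> e t)" if "\<alpha> @ [e] \<in> traces \<E>"
    using *[OF traces_snocD[OF that]] that by auto
  show "(\<Sum>e\<in>enabled \<E> \<alpha>. mass (the (\<sigma> \<alpha> (e, t))) UNIV) = 1" if "\<alpha> \<in> traces \<E> - max_traces \<E>"
  proof -
    have "enabled \<E> \<alpha> \<noteq> {}" using that by (simp add: max_traces_iff)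
    then show ?thesis using *[of \<alpha>] that by auto
  qed
qed

text \<open>Conversely the mass serves as weight; it is at most 1, being one of the non-negative
  terms of a sum equal to 1.\<close>

lemma scheduler_of_weights:
  assumes wl: "well_labelled \<E>" and fb: "finitely_branching \<E>"
    and V: "\<And>\<alpha> e t. \<alpha> @ [e] \<in> traces \<E> \<Longrightarrow> V \<alpha> e t \<in> scaled (label \<E> e t)"
    and sum1: "\<And>\<alpha> t. \<alpha> \<in> traces \<E> - max_traces \<E> \<Longrightarrow> (\<Sum>e\<in>enabled \<E> \<alpha>. mass (V \<alpha> e t) UNIV) = 1"
  shows "scheduler \<E> (\<lambda>\<alpha> (e, t). if e \<in> enabled \<E> \<alpha> then Some (V \<alpha> e t) else None)"
    (is "scheduler \<E> ?\<sigma>")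
  unfolding scheduler_def
proof (intro ballI)
  fix \<alpha> assume \<alpha>: "\<alpha> \<in> traces \<E>"
  have fin: "finite (enabled \<E> \<alpha>)"
    using fb \<alpha> by (simp add: finitely_branching_def)
  \<comment> \<open>Weight 0 off the enabled events, because the range condition concerns all
    events.\<close>
  define w where "w = (\<lambda>(e, t). if e \<in> enabled \<E> \<alpha> then mass (V \<alpha> e t) UNIV else 0)"
  have nonneg: "0 \<le> V \<alpha> e t $ s" if "e \<in> enabled \<E> \<alpha>" for e t s
    using V[of \<alpha> e t] label_distributions[OF wl] that by (intro scaled_nonneg) auto
  have w01: "mass (V \<alpha> e t) UNIV \<in> {0..1}" if e: "e \<in> enabled \<E> \<alpha>" for e t
  proof -
    have "\<alpha> \<in> traces \<E> - max_traces \<E>"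
      using \<alpha> snoc_not_max[of \<alpha> e \<E>] e by simp
    moreover have "mass (V \<alpha> e t) UNIV \<le> (\<Sum>e\<in>enabled \<E> \<alpha>. mass (V \<alpha> e t) UNIV)"
      using fin e nonneg by (intro member_le_sum) (auto simp del: enabled_iff intro!: mass_nonneg)
    moreover have "0 \<le> mass (V \<alpha> e t) UNIV"
      using nonneg[OF e] by (rule mass_nonneg)
    ultimately show ?thesis using sum1 by simp
  qed
  have "V \<alpha> e t \<in> subdistributions" if "e \<in> enabled \<E> \<alpha>" for e t
    using w01[OF that, of t] nonneg[OF that, of t] by (simp add: subdistributions_def mass_def)
  then have "ran (?\<sigma> \<alpha>) \<subseteq> subdistributions"
    by (auto simp: ran_def simp del: enabled_iff split: if_splits)
  moreover have "dom (?\<sigma> \<alpha>) = enabled \<E> \<alpha> \<times> UNIV"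
    by (auto simp: dom_def simp del: enabled_iff split: if_splits)
  moreover have "\<forall>e\<in>events \<E>. \<forall>t. w (e, t) \<in> {0..1}"
    using w01 by (simp add: w_def del: enabled_iff)
  moreover have "(label \<E> e t \<noteq> {} \<longrightarrow> (\<exists>\<mu>\<in>label \<E> e t. ?\<sigma> \<alpha> (e, t) = Some (w (e, t) *\<^sub>R \<mu>))) \<and>
      (label \<E> e t = {} \<longrightarrow> w (e, t) = 0 \<and> ?\<sigma> \<alpha> (e, t) = Some 0)" if e: "e \<in> enabled \<E> \<alpha>" for e t
  proof (intro conjI impI)
    assume "label \<E> e t \<noteq> {}"
    then have "\<exists>\<mu>\<in>label \<E> e t. V \<alpha> e t = mass (V \<alpha> e t) UNIV *\<^sub>R \<mu>"
      using V[of \<alpha> e t] label_distributions[OF wl] e by (intro scaled_conv_mass) auto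
    then show "\<exists>\<mu>\<in>label \<E> e t. ?\<sigma> \<alpha> (e, t) = Some (w (e, t) *\<^sub>R \<mu>)"
      using e by (simp add: w_def del: enabled_iff)
  next
    assume "label \<E> e t = {}"
    then have "V \<alpha> e t = 0"
      using V[of \<alpha> e t] e by (simp add: scaled_def)
    then show "w (e, t) = 0" "?\<sigma> \<alpha> (e, t) = Some 0"
      using e by (simp_all add: w_def)
  qed
  moreover have "((\<lambda>e. w (e, t)) has_sum 1) (enabled \<E> \<alpha>)" if "enabled \<E> \<alpha> \<noteq> {}" for t
    using sum1[of \<alpha> t] that \<alpha> fin
    by (intro has_sum_finiteI) (simp_all add: w_def max_traces_iff del: enabled_iff)
  ultimately show "dom (?\<sigma> \<alpha>) = enabled \<E> \<alpha> \<times> UNIV \<and> ran (?\<sigma> \<alpha>) \<subseteq> subdistributions \<and>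
     (\<exists>w :: 'a \<times> 'b \<Rightarrow> real. (\<forall>e\<in>events \<E>. \<forall>s. w (e, s) \<in> {0..1}) \<and>
        (\<forall>e\<in>enabled \<E> \<alpha>. \<forall>s.
           (label \<E> e s \<noteq> {} \<longrightarrow> (\<exists>\<mu>\<in>label \<E> e s. ?\<sigma> \<alpha> (e, s) = Some (w (e, s) *\<^sub>R \<mu>))) \<and>
           (label \<E> e s = {} \<longrightarrow> w (e, s) = 0 \<and> ?\<sigma> \<alpha> (e, s) = Some 0)) \<and>
        (enabled \<E> \<alpha> \<noteq> {} \<longrightarrow> (\<forall>s. ((\<lambda>e. w (e, s)) has_sum 1) (enabled \<E> \<alpha>))))"
    by (intro conjI exI[of _ w]) auto
qed

lemma phi_snoc: "phi \<sigma> s (\<alpha> @ [e]) = (\<Sum>t\<in>UNIV. (phi \<sigma> s \<alpha> $ t) *\<^sub>R the (\<sigma> \<alpha> (e, t)))"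
  by (simp add: vec_eq_iff mult.commute)

declare phi.simps(2) [simp del]

section \<open>Trace probabilities of a scheduler and convergence of the outcome\<close>

context
  fixes \<E> :: "('e, 's::finite) ipbes" and \<sigma>
  assumes \<sigma>: "scheduler \<E> \<sigma>" and wl: "well_labelled \<E>" and fb: "finitely_branching \<E>"
begin

lemma phi_nonneg: "\<alpha> \<in> traces \<E> \<Longrightarrow> 0 \<le> phi \<sigma> s \<alpha> $ u"
proof (induction arbitrary: u rule: traces_induct)
  case (snoc \<alpha> e)
  have "0 \<le> the (\<sigma> \<alpha> (e, t)) $ u" for t
    using scheduler_imp_weights(1)[OF \<sigma> wl fb snoc.hyps(1)] label_distributions[OF wl snoc.hyps(1)]
    by (rule scaled_nonneg[rotated])
  then show ?case
    using snoc.IH by (simp add: phi_snoc sum_nonneg)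
qed (simp add: point_nth)

text \<open>From each state the weights of the enabled events add up to 1, so executing an event
  only redistributes mass.\<close>

lemma sum_mass_phi_snoc:
  assumes "\<alpha> \<in> traces \<E> - max_traces \<E>"
  shows "(\<Sum>e\<in>enabled \<E> \<alpha>. mass (phi \<sigma> s (\<alpha> @ [e])) UNIV) = mass (phi \<sigma> s \<alpha>) UNIV"
proof -
  have "(\<Sum>e\<in>enabled \<E> \<alpha>. mass (phi \<sigma> s (\<alpha> @ [e])) UNIV) =
      (\<Sum>t\<in>UNIV. phi \<sigma> s \<alpha> $ t * (\<Sum>e\<in>enabled \<E> \<alpha>. mass (the (\<sigma> \<alpha> (e, t))) UNIV))"
    unfolding phi_snoc mass_sum mass_scaleR by (subst sum.swap) (simp add: sum_distrib_left)
  also have "\<dots> = mass (phi \<sigma> s \<alpha>) UNIV"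
    unfolding scheduler_imp_weights(2)[OF \<sigma> wl fb assms] by (simp add: mass_def)
  finally show ?thesis .
qed

text \<open>For each \<open>n\<close>, the traces of length \<open>n\<close> and the shorter maximal ones together carry mass 1.\<close>

lemma sum_mass_phi_max_le_1:
  assumes "finite M" "M \<subseteq> max_traces \<E>"
  shows "(\<Sum>\<alpha>\<in>M. mass (phi \<sigma> s \<alpha>) UNIV) \<le> 1"
proof -
  define L where "L n = {\<alpha> \<in> traces \<E>. length \<alpha> = n \<or> \<alpha> \<in> max_traces \<E> \<and> length \<alpha> \<le> n}" for n
  \<comment> \<open>One step keeps the maximal traces and replaces every other one by its one-event
    extensions.\<close>
  have L_Suc: "L (Suc n) = (L n \<inter> max_traces \<E>) \<union>
      (\<Union>\<alpha>\<in>L n - max_traces \<E>. (\<lambda>e. \<alpha> @ [e]) ` enabled \<E> \<alpha>)" for n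
  proof (rule set_eqI)
    fix \<beta>
    show "\<beta> \<in> L (Suc n) \<longleftrightarrow> \<beta> \<in> (L n \<inter> max_traces \<E>) \<union>
        (\<Union>\<alpha>\<in>L n - max_traces \<E>. (\<lambda>e. \<alpha> @ [e]) ` enabled \<E> \<alpha>)"
      by (cases \<beta> rule: rev_cases)
         (auto simp: L_def image_iff max_traces_iff dest: traces_snocD snoc_not_max)
  qed
  have L: "finite (L n) \<and> (\<Sum>\<alpha>\<in>L n. mass (phi \<sigma> s \<alpha>) UNIV) = 1" for n
  proof (induction n)
    case 0
    have "L 0 = {[]}" by (auto simp: L_def)
    then show ?case by simp
  next
    case (Suc n)
    let ?N = "L n - max_traces \<E>"
    have fin: "finite (enabled \<E> \<alpha>)" if "\<alpha> \<in> L n" for \<alpha>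
      using fb that by (simp add: finitely_branching_def L_def)
    have finU: "finite (\<Union>\<alpha>\<in>?N. (\<lambda>e. \<alpha> @ [e]) ` enabled \<E> \<alpha>)"
      using Suc.IH fin by blast
    have "(\<Sum>\<alpha>\<in>L (Suc n). mass (phi \<sigma> s \<alpha>) UNIV) =
        (\<Sum>\<alpha>\<in>L n \<inter> max_traces \<E>. mass (phi \<sigma> s \<alpha>) UNIV) +
        (\<Sum>\<beta>\<in>(\<Union>\<alpha>\<in>?N. (\<lambda>e. \<alpha> @ [e]) ` enabled \<E> \<alpha>). mass (phi \<sigma> s \<beta>) UNIV)"
    proof (unfold L_Suc, rule sum.union_disjoint)
      show "L n \<inter> max_traces \<E> \<inter> (\<Union>\<alpha>\<in>?N. (\<lambda>e. \<alpha> @ [e]) ` enabled \<E> \<alpha>) = {}"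
        by (auto simp: L_def)
    qed (use Suc.IH finU in auto)
    also have "(\<Sum>\<beta>\<in>(\<Union>\<alpha>\<in>?N. (\<lambda>e. \<alpha> @ [e]) ` enabled \<E> \<alpha>). mass (phi \<sigma> s \<beta>) UNIV) =
        (\<Sum>\<alpha>\<in>?N. \<Sum>\<beta>\<in>(\<lambda>e. \<alpha> @ [e]) ` enabled \<E> \<alpha>. mass (phi \<sigma> s \<beta>) UNIV)"
      using Suc.IH fin by (intro sum.UNION_disjoint) auto
    also have "\<dots> = (\<Sum>\<alpha>\<in>?N. mass (phi \<sigma> s \<alpha>) UNIV)"
    proof (intro sum.cong refl)
      fix \<alpha> assume "\<alpha> \<in> ?N"
      then have "\<alpha> \<in> traces \<E> - max_traces \<E>" by (simp add: L_def)
      then show "(\<Sum>\<beta>\<in>(\<lambda>e. \<alpha> @ [e]) ` enabled \<E> \<alpha>. mass (phi \<sigma> s \<beta>) UNIV) = mass (phi \<sigma> s \<alpha>) UNIV"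
        by (subst sum.reindex) (simp_all add: inj_on_def sum_mass_phi_snoc del: enabled_iff)
    qed
    also have "(\<Sum>\<alpha>\<in>L n \<inter> max_traces \<E>. mass (phi \<sigma> s \<alpha>) UNIV) + \<dots> =
        (\<Sum>\<alpha>\<in>L n. mass (phi \<sigma> s \<alpha>) UNIV)"
      using Suc.IH by (metis sum.Int_Diff)
    finally show ?case
      using Suc.IH finU by (simp add: L_Suc)
  qed
  define n where "n = Max (insert 0 (length ` M))"
  have "M \<subseteq> L n"
    using assms by (auto simp: L_def n_def max_tracesD)
  then have "(\<Sum>\<alpha>\<in>M. mass (phi \<sigma> s \<alpha>) UNIV) \<le> (\<Sum>\<alpha>\<in>L n. mass (phi \<sigma> s \<alpha>) UNIV)"
    using L[of n] by (intro sum_mono2 mass_nonneg phi_nonneg) (auto simp: L_def)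
  then show ?thesis using L by simp
qed

text \<open>Non-negativity bounds norms by masses, whose finite sums are at most 1. The family
  converges absolutely, so \<open>infsum\<close> is its true sum.\<close>

lemma phi_has_sum_outcome: "(phi \<sigma> s has_sum outcome \<E> \<sigma> s) (max_traces \<E>)"
proof -
  have "(\<lambda>\<alpha>. norm (phi \<sigma> s \<alpha>)) summable_on max_traces \<E>"
  proof (rule nonneg_bdd_above_summable_on)
    have "norm (phi \<sigma> s \<alpha>) \<le> mass (phi \<sigma> s \<alpha>) UNIV" if "\<alpha> \<in> max_traces \<E>" for \<alpha>
    proof -
      have "norm (phi \<sigma> s \<alpha>) \<le> (\<Sum>u\<in>UNIV. \<bar>phi \<sigma> s \<alpha> $ u\<bar>)"
        by (rule norm_le_l1_cart)
      then show ?thesis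
        using phi_nonneg[OF max_tracesD[OF that]] by (simp add: mass_def)
    qed
    then have "(\<Sum>\<alpha>\<in>M. norm (phi \<sigma> s \<alpha>)) \<le> 1" if "finite M" "M \<subseteq> max_traces \<E>" for M
      using sum_mass_phi_max_le_1[OF that, of s] that(2)
      by (smt (verit, best) sum_mono subsetD)
    then show "bdd_above (sum (\<lambda>\<alpha>. norm (phi \<sigma> s \<alpha>)) ` {M. M \<subseteq> max_traces \<E> \<and> finite M})"
      by (intro bdd_aboveI[of _ 1]) auto
  qed simp
  then show ?thesis
    unfolding outcome_def by (rule has_sum_infsum[OF abs_summable_summable])
qed

lemma outcome_nonneg: "0 \<le> outcome \<E> \<sigma> s $ u"
proof (rule has_sum_nonneg)
  show "((\<lambda>\<alpha>. phi \<sigma> s \<alpha> $ u) has_sum outcome \<E> \<sigma> s $ u) (max_traces \<E>)"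
    using has_sum_bounded_linear[OF bounded_linear_vec_nth phi_has_sum_outcome] .
qed (auto intro: phi_nonneg max_tracesD)

lemma mass_outcome_le_1: "mass (outcome \<E> \<sigma> s) UNIV \<le> 1"
proof (rule has_sum_le_finite_sums)
  show "((\<lambda>\<alpha>. mass (phi \<sigma> s \<alpha>) UNIV) has_sum mass (outcome \<E> \<sigma> s) UNIV) (max_traces \<E>)"
    using has_sum_bounded_linear[OF bounded_linear_mass phi_has_sum_outcome] .
qed (rule sum_mass_phi_max_le_1)

end

subsection \<open>Flows\<close>

text \<open>\<open>\<psi> \<alpha> $ t\<close> is the probability of executing \<open>\<alpha>\<close> and then being in state \<open>t\<close>, and
  \<open>q (\<alpha> @ [e]) t\<close> the part of \<open>\<psi> (\<alpha> @ [e])\<close> that was in state \<open>t\<close> before \<open>e\<close>.  Unlike the behaviour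
  of a scheduler, this is linear data.\<close>

definition flow ::
    "('e, 's::finite) ipbes \<Rightarrow> ('e list \<Rightarrow> real ^ 's) \<Rightarrow> ('e list \<Rightarrow> 's \<Rightarrow> real ^ 's) \<Rightarrow> bool" where
  "flow \<E> \<psi> q \<longleftrightarrow> (\<forall>t. 0 \<le> \<psi> [] $ t) \<and>
     (\<forall>\<alpha> e. \<alpha> @ [e] \<in> traces \<E> \<longrightarrow>
        \<psi> (\<alpha> @ [e]) = (\<Sum>t\<in>UNIV. q (\<alpha> @ [e]) t) \<and> (\<forall>t. q (\<alpha> @ [e]) t \<in> scaled (label \<E> e t))) \<and>
     (\<forall>\<alpha>\<in>traces \<E> - max_traces \<E>. \<forall>t.
        (\<Sum>e\<in>enabled \<E> \<alpha>. mass (q (\<alpha> @ [e]) t) UNIV) = \<psi> \<alpha> $ t)"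

definition mix_phi :: "('s::finite \<Rightarrow> real) \<Rightarrow> ('e, 's) sched \<Rightarrow> 'e list \<Rightarrow> real ^ 's" where
  "mix_phi \<nu> \<sigma> \<alpha> = (\<Sum>s\<in>UNIV. \<nu> s *\<^sub>R phi \<sigma> s \<alpha>)"

lemma mix_phi_Nil [simp]: "mix_phi \<nu> \<sigma> [] $ s = \<nu> s"
  by (simp add: mix_phi_def point_nth if_distrib cong: if_cong)

lemma mix_phi_snoc:
  "mix_phi \<nu> \<sigma> (\<alpha> @ [e]) = (\<Sum>t\<in>UNIV. (mix_phi \<nu> \<sigma> \<alpha> $ t) *\<^sub>R the (\<sigma> \<alpha> (e, t)))"
  unfolding mix_phi_def phi_snoc scaleR_sum_right
  by (subst sum.swap) (simp add: scaleR_sum_left)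

text \<open>A flow is indexed by the trace after the event; \<open>butlast\<close> and
  \<open>last\<close> recover the point of decision.\<close>

lemma flow_of_scheduler:
  assumes \<sigma>: "scheduler \<E> \<sigma>" and wl: "well_labelled \<E>" and fb: "finitely_branching \<E>"
    and \<nu>: "\<And>s. 0 \<le> \<nu> s"
  shows "flow \<E> (mix_phi \<nu> \<sigma>)
     (\<lambda>\<alpha> t. (mix_phi \<nu> \<sigma> (butlast \<alpha>) $ t) *\<^sub>R the (\<sigma> (butlast \<alpha>) (last \<alpha>, t)))"
proof -
  have nonneg: "0 \<le> mix_phi \<nu> \<sigma> \<alpha> $ t" if "\<alpha> \<in> traces \<E>" for \<alpha> t
    using phi_nonneg[OF \<sigma> wl fb that] \<nu> by (simp add: mix_phi_def sum_nonneg)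
  show ?thesis
    unfolding flow_def
  proof (intro conjI allI impI ballI)
    fix \<alpha> e t assume \<alpha>: "\<alpha> @ [e] \<in> traces \<E>"
    show "(mix_phi \<nu> \<sigma> (butlast (\<alpha> @ [e])) $ t) *\<^sub>R
        the (\<sigma> (butlast (\<alpha> @ [e])) (last (\<alpha> @ [e]), t)) \<in> scaled (label \<E> e t)"
      using scheduler_imp_weights(1)[OF \<sigma> wl fb \<alpha>] nonneg[OF traces_snocD[OF \<alpha>]]
      by (simp add: scaleR_in_scaled)
  next
    fix \<alpha> t assume \<alpha>: "\<alpha> \<in> traces \<E> - max_traces \<E>"
    show "(\<Sum>e\<in>enabled \<E> \<alpha>. mass ((mix_phi \<nu> \<sigma> (butlast (\<alpha> @ [e])) $ t) *\<^sub>R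
        the (\<sigma> (butlast (\<alpha> @ [e])) (last (\<alpha> @ [e]), t))) UNIV) = mix_phi \<nu> \<sigma> \<alpha> $ t"
      using scheduler_imp_weights(2)[OF \<sigma> wl fb \<alpha>] by (simp add: sum_distrib_left[symmetric])
  qed (simp_all add: \<nu> mix_phi_snoc)
qed

text \<open>The scheduler is the flow conditioned on having executed \<alpha> and being in state
  \<open>t\<close>. Where this has probability 0, feasibility supplies an event with non-empty label
  as default.\<close>

lemma scheduler_of_flow:
  assumes fl: "flow \<E> \<psi> q" and wl: "well_labelled \<E>" and fb: "finitely_branching \<E>"
    and feas: "feasible \<E>"
  obtains \<sigma> where "scheduler \<E> \<sigma>" "\<And>\<alpha>. \<alpha> \<in> traces \<E> \<Longrightarrow> mix_phi (\<lambda>s. \<psi> [] $ s) \<sigma> \<alpha> = \<psi> \<alpha>"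
proof -
  have q: "q (\<alpha> @ [e]) t \<in> scaled (label \<E> e t)" "\<psi> (\<alpha> @ [e]) = (\<Sum>t\<in>UNIV. q (\<alpha> @ [e]) t)"
    if "\<alpha> @ [e] \<in> traces \<E>" for \<alpha> e t
    using fl that unfolding flow_def by blast+
  have bal: "(\<Sum>e\<in>enabled \<E> \<alpha>. mass (q (\<alpha> @ [e]) t) UNIV) = \<psi> \<alpha> $ t"
    if "\<alpha> \<in> traces \<E> - max_traces \<E>" for \<alpha> t
    using fl that unfolding flow_def by blast
  have q0: "0 \<le> q (\<alpha> @ [e]) t $ u" if "\<alpha> @ [e] \<in> traces \<E>" for \<alpha> e t u
    using q(1)[OF that] label_distributions[OF wl that] scaled_nonneg by blast
  have fin: "finite (enabled \<E> \<alpha>)" if "\<alpha> \<in> traces \<E>" for \<alpha>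
    using fb that by (simp add: finitely_branching_def)
  have "\<exists>e \<mu>. e \<in> enabled \<E> \<alpha> \<and> \<mu> \<in> label \<E> e t" if "\<alpha> \<in> traces \<E> - max_traces \<E>" for \<alpha> t
  proof -
    have "t \<in> (\<Union>e\<in>enabled \<E> \<alpha>. {s. label \<E> e s \<noteq> {}})"
      using feas that unfolding feasible_def by simp
    then show ?thesis by blast
  qed
  then obtain d m where d: "d \<alpha> t \<in> enabled \<E> \<alpha>" "m \<alpha> t \<in> label \<E> (d \<alpha> t) t"
    if "\<alpha> \<in> traces \<E> - max_traces \<E>" for \<alpha> t
    by metis
  define V where "V \<alpha> e t = (if 0 < \<psi> \<alpha> $ t then (1 / \<psi> \<alpha> $ t) *\<^sub>R q (\<alpha> @ [e]) t
      else if e = d \<alpha> t then m \<alpha> t else 0)" for \<alpha> e t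
  have V: "V \<alpha> e t \<in> scaled (label \<E> e t)" if "\<alpha> @ [e] \<in> traces \<E>" for \<alpha> e t
    using q(1)[OF that] d(2)[of \<alpha> t] subset_scaled that traces_snocD[OF that] snoc_not_max[OF that]
    by (auto simp: V_def intro!: scaleR_in_scaled)
  have V1: "(\<Sum>e\<in>enabled \<E> \<alpha>. mass (V \<alpha> e t) UNIV) = 1" if \<alpha>: "\<alpha> \<in> traces \<E> - max_traces \<E>" for \<alpha> t
  proof (cases "0 < \<psi> \<alpha> $ t")
    case True
    then show ?thesis
      using bal[OF \<alpha>, of t] by (simp add: V_def sum_divide_distrib[symmetric])
  next
    case False
    have "mass (m \<alpha> t) UNIV = 1"
      using d[OF \<alpha>, of t] label_mass[OF wl] by simp
    then have "(\<Sum>e\<in>enabled \<E> \<alpha>. mass (V \<alpha> e t) UNIV) = (\<Sum>e\<in>enabled \<E> \<alpha>. if e = d \<alpha> t then 1 else 0)"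
      using False by (intro sum.cong) (auto simp: V_def)
    then show ?thesis
      using d(1)[OF \<alpha>, of t] fin[of \<alpha>] \<alpha> by simp
  qed
  define \<sigma> where "\<sigma> = (\<lambda>\<alpha> (e, t). if e \<in> enabled \<E> \<alpha> then Some (V \<alpha> e t) else None)"
  have "scheduler \<E> \<sigma>"
    unfolding \<sigma>_def by (rule scheduler_of_weights[OF wl fb V V1])
  moreover have "mix_phi (\<lambda>s. \<psi> [] $ s) \<sigma> \<alpha> = \<psi> \<alpha>" if "\<alpha> \<in> traces \<E>" for \<alpha>
    using that
  proof (induction rule: traces_induct)
    case Nil
    show ?case by (simp add: vec_eq_iff)
  next
    case (snoc \<alpha> e)
    have \<alpha>: "\<alpha> \<in> traces \<E> - max_traces \<E>"
      using snoc.hyps snoc_not_max[OF snoc.hyps(1)] by simp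
    \<comment> \<open>Where \<psi> vanishes, balance and non-negativity make every outgoing
      \<open>q\<close> vanish too, so the default leaves no trace.\<close>
    have "(\<psi> \<alpha> $ t) *\<^sub>R V \<alpha> e t = q (\<alpha> @ [e]) t" for t
    proof (cases "0 < \<psi> \<alpha> $ t")
      case False
      have nonneg: "0 \<le> mass (q (\<alpha> @ [e']) t) UNIV" if "e' \<in> enabled \<E> \<alpha>" for e'
        using q0[of \<alpha> e' t] that by (intro mass_nonneg) auto
      then have "0 \<le> \<psi> \<alpha> $ t"
        unfolding bal[OF \<alpha>, symmetric] by (rule sum_nonneg)
      with False have "\<psi> \<alpha> $ t = 0" by simp
      moreover from this have "mass (q (\<alpha> @ [e]) t) UNIV = 0"
        using bal[OF \<alpha>, of t] sum_nonneg_eq_0_iff[OF fin nonneg] snoc.hyps by auto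
      ultimately show ?thesis
        using mass_UNIV_eq_0_iff[of "q (\<alpha> @ [e]) t"] q0[OF snoc.hyps(1)] by simp
    qed (simp add: V_def)
    then show ?case
      using snoc by (simp add: mix_phi_snoc \<sigma>_def q(2))
  qed
  ultimately show thesis by (rule that)
qed

section \<open>Soundness of simulation\<close>

text \<open>The flow is given on an abstract forest of nodes, which \<open>G\<close> maps to traces.  The flow into a
  trace \<open>\<beta>\<close> is collected from the nodes at which the branches enter the finite fibre of \<open>\<beta>\<close>.\<close>

lemma flow_pushforward:
  fixes \<F> :: "('f, 's::finite) ipbes" and N :: "'n set" and rt and parent
    and Q :: "'n \<Rightarrow> 's \<Rightarrow> real ^ 's"
  defines "Ch \<equiv> \<lambda>n. {m \<in> N. m \<noteq> rt \<and> parent m = n}"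
  assumes wl: "well_labelled \<F>" and fb: "finitely_branching \<F>"
    and root: "rt \<in> N" "G rt = []" "\<And>t. 0 \<le> \<Psi> rt $ t"
    and parent: "\<And>n. n \<in> N \<Longrightarrow> n \<noteq> rt \<Longrightarrow> parent n \<in> N"
    and G: "\<And>n. n \<in> N \<Longrightarrow> G n \<in> traces \<F>"
    and finG: "\<And>\<beta>. \<beta> \<in> traces \<F> \<Longrightarrow> finite {n \<in> N. G n = \<beta>}"
    and \<Psi>: "\<And>n. n \<in> N \<Longrightarrow> n \<noteq> rt \<Longrightarrow> \<Psi> n = (\<Sum>t\<in>UNIV. Q n t)"
    and step: "\<And>n. n \<in> N \<Longrightarrow> n \<noteq> rt \<Longrightarrow>
        (G n = G (parent n) \<and> (\<forall>t. Q n t \<in> scaled {point t})) \<or>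
        (\<exists>e'. G n = G (parent n) @ [e'] \<and> (\<forall>t. Q n t \<in> scaled (label \<F> e' t)))"
    and bal: "\<And>n t. n \<in> N \<Longrightarrow> Ch n \<noteq> {} \<Longrightarrow>
        (\<Sum>m\<in>Ch n. mass (Q m t) UNIV) = \<Psi> n $ t"
    and leaf: "\<And>n. n \<in> N \<Longrightarrow> Ch n = {} \<Longrightarrow> G n \<in> max_traces \<F>"
  obtains \<psi> q where "flow \<F> \<psi> q" "\<psi> [] = \<Psi> rt"
    "\<And>\<beta>. \<beta> \<in> max_traces \<F> \<Longrightarrow> \<psi> \<beta> = (\<Sum>n | n \<in> N \<and> Ch n = {} \<and> G n = \<beta>. \<Psi> n)"
proof -
  define Fib where "Fib \<beta> = {n \<in> N. G n = \<beta>}" for \<beta>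
  \<comment> \<open>\<open>I\<close> collects the nodes at which a branch enters a fibre,
    \<open>S\<close> those reached by stuttering inside it.\<close>
  define I where "I \<beta> = {n \<in> N. n \<noteq> rt \<and> G n = \<beta> \<and> G (parent n) \<noteq> \<beta>}" for \<beta>
  define S where "S \<beta> = {n \<in> N. n \<noteq> rt \<and> G n = \<beta> \<and> G (parent n) = \<beta>}" for \<beta>
  define \<psi> where "\<psi> \<beta> = (if \<beta> = [] then \<Psi> rt else \<Sum>n\<in>I \<beta>. \<Psi> n)" for \<beta>
  define q where "q \<beta> t = (\<Sum>n\<in>I \<beta>. Q n t)" for \<beta> t
  have fin: "finite (Fib \<beta>)" "finite (I \<beta>)" "finite (S \<beta>)" if "\<beta> \<in> traces \<F>" for \<beta>
  proof -
    show "finite (Fib \<beta>)" using finG[OF that] by (simp add: Fib_def)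
    then show "finite (I \<beta>)" "finite (S \<beta>)"
      by (auto elim!: rev_finite_subset simp: Fib_def I_def S_def)
  qed
  \<comment> \<open>Entering a fibre appends an event, so the empty trace is reached first at the
    root; hence the separate case in \<psi>.\<close>
  have I_Nil: "I [] = {}"
    using step by (fastforce simp: I_def)
  have I_snoc: "parent m \<in> N" "G (parent m) = \<beta>" "\<forall>t. Q m t \<in> scaled (label \<F> e t)"
    if "m \<in> I (\<beta> @ [e])" for m \<beta> e
    using that step[of m] parent[of m] by (auto simp: I_def)
  \<comment> \<open>A child of a fibre stutters in it or enters the fibre of a one-event
    extension.\<close>
  have Ch_Fib: "(\<Union>n\<in>Fib \<beta>. Ch n) = S \<beta> \<union> (\<Union>e\<in>enabled \<F> \<beta>. I (\<beta> @ [e]))"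
    if "\<beta> \<in> traces \<F>" for \<beta>
  proof (intro subset_antisym subsetI)
    fix m assume "m \<in> (\<Union>n\<in>Fib \<beta>. Ch n)"
    then have m: "m \<in> N" "m \<noteq> rt" "G (parent m) = \<beta>"
      by (auto simp: Fib_def Ch_def)
    show "m \<in> S \<beta> \<union> (\<Union>e\<in>enabled \<F> \<beta>. I (\<beta> @ [e]))"
    proof (cases "G m = \<beta>")
      case False
      then obtain e where e: "G m = \<beta> @ [e]" using step[OF m(1,2)] m(3) by auto
      then have "m \<in> I (\<beta> @ [e])" using m by (simp add: I_def)
      then show ?thesis using G[OF m(1)] e by auto
    qed (use m in \<open>simp add: S_def\<close>)
  next
    fix m assume "m \<in> S \<beta> \<union> (\<Union>e\<in>enabled \<F> \<beta>. I (\<beta> @ [e]))"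
    then consider "m \<in> S \<beta>" | e where "m \<in> I (\<beta> @ [e])" by blast
    then have "m \<in> N \<and> m \<noteq> rt \<and> parent m \<in> Fib \<beta>"
    proof cases
      case 1
      then show ?thesis using parent by (auto simp: S_def Fib_def)
    next
      case 2
      then show ?thesis using I_snoc[OF 2] by (auto simp: I_def Fib_def)
    qed
    then show "m \<in> (\<Union>n\<in>Fib \<beta>. Ch n)" by (auto simp: Ch_def)
  qed
  have finCh: "finite (Ch n)" if "n \<in> N" for n
  proof (rule finite_subset)
    have "\<beta> @ [e] \<in> traces \<F>" if "e \<in> enabled \<F> \<beta>" for \<beta> e using that by simp
    then show "finite (\<Union>n\<in>Fib (G n). Ch n)"
      using fb G[OF that] fin(2,3) unfolding Ch_Fib[OF G[OF that]] finitely_branching_def by blast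
    show "Ch n \<subseteq> (\<Union>n\<in>Fib (G n). Ch n)" using that by (auto simp: Fib_def)
  qed
  \<comment> \<open>\<Psi> is summed over the fibre in two ways: by how its nodes are reached and by
    where their flow goes. The finite contribution of \<open>S\<close> occurs on both sides and
    cancels.\<close>
  have balance: "\<psi> \<beta> $ t = (\<Sum>n | n \<in> N \<and> Ch n = {} \<and> G n = \<beta>. \<Psi> n $ t) +
      (\<Sum>e\<in>enabled \<F> \<beta>. mass (q (\<beta> @ [e]) t) UNIV)" if \<beta>: "\<beta> \<in> traces \<F>" for \<beta> t
  proof -
    let ?M = "\<lambda>m. mass (Q m t) UNIV"
    let ?L = "{n \<in> N. Ch n = {} \<and> G n = \<beta>}"
    have "(\<Sum>n\<in>Fib \<beta>. \<Psi> n $ t) = \<psi> \<beta> $ t + (\<Sum>n\<in>S \<beta>. \<Psi> n $ t)"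
    proof (cases "\<beta> = []")
      case True
      have "Fib \<beta> = insert rt (S \<beta>)" "rt \<notin> S \<beta>"
        using True I_Nil root by (auto simp: Fib_def S_def I_def)
      then show ?thesis using True fin(3)[OF \<beta>] by (simp add: \<psi>_def)
    next
      case False
      have "Fib \<beta> = I \<beta> \<union> S \<beta>" "I \<beta> \<inter> S \<beta> = {}"
        using False root(2) by (auto simp: Fib_def S_def I_def)
      then show ?thesis using False fin[OF \<beta>] by (simp add: \<psi>_def sum.union_disjoint)
    qed
    \<comment> \<open>A stuttering step keeps the state: \<open>Q m u\<close> lives at
      \<open>u\<close> alone, so its mass is the coordinate of \<open>\<Psi> m\<close>
      there.\<close>
    moreover have "(\<Sum>n\<in>S \<beta>. \<Psi> n $ t) = (\<Sum>m\<in>S \<beta>. ?M m)"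
    proof (rule sum.cong[OF refl])
      fix m assume m: "m \<in> S \<beta>"
      then have "Q m u \<in> scaled {point u}" for u
        using step[of m] by (auto simp: S_def)
      then have "Q m u $ t = ((mass (Q m u) UNIV) *\<^sub>R point u) $ t" for u
        using scaled_point by metis
      then have "Q m u $ t = (if u = t then ?M m else 0)" for u
        by (simp add: point_nth)
      then show "\<Psi> m $ t = ?M m"
        using m by (simp add: S_def \<Psi>)
    qed
    moreover have "(\<Sum>n\<in>Fib \<beta>. \<Psi> n $ t) = (\<Sum>n\<in>?L. \<Psi> n $ t) + (\<Sum>n\<in>Fib \<beta>. \<Sum>m\<in>Ch n. ?M m)"
    proof -
      have L: "?L \<subseteq> Fib \<beta>" by (auto simp: Fib_def)
      have "(\<Sum>n\<in>Fib \<beta> - ?L. \<Psi> n $ t) = (\<Sum>n\<in>Fib \<beta> - ?L. \<Sum>m\<in>Ch n. ?M m)"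
      proof (rule sum.cong[OF refl])
        fix n assume "n \<in> Fib \<beta> - ?L"
        then have "n \<in> N" "Ch n \<noteq> {}" by (auto simp: Fib_def)
        then show "\<Psi> n $ t = (\<Sum>m\<in>Ch n. ?M m)" by (rule bal[symmetric])
      qed
      moreover have "(\<Sum>n\<in>?L. \<Sum>m\<in>Ch n. ?M m) = 0" by simp
      ultimately show ?thesis
        using sum.subset_diff[OF L fin(1)[OF \<beta>], of "\<lambda>n. \<Psi> n $ t"]
          sum.subset_diff[OF L fin(1)[OF \<beta>], of "\<lambda>n. \<Sum>m\<in>Ch n. ?M m"] by simp
    qed
    moreover have "(\<Sum>n\<in>Fib \<beta>. \<Sum>m\<in>Ch n. ?M m) = (\<Sum>m\<in>(\<Union>n\<in>Fib \<beta>. Ch n). ?M m)"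
    proof (rule sum.UNION_disjoint[symmetric])
      show "\<forall>n\<in>Fib \<beta>. finite (Ch n)" using finCh by (simp add: Fib_def)
    qed (use fin(1)[OF \<beta>] in \<open>auto simp: Ch_def\<close>)
    moreover have "\<dots> = (\<Sum>m\<in>S \<beta>. ?M m) + (\<Sum>m\<in>(\<Union>e\<in>enabled \<F> \<beta>. I (\<beta> @ [e])). ?M m)"
      unfolding Ch_Fib[OF \<beta>]
    proof (rule sum.union_disjoint)
      show "finite (\<Union>e\<in>enabled \<F> \<beta>. I (\<beta> @ [e]))"
        using fb \<beta> fin(2) by (auto simp: finitely_branching_def)
      show "S \<beta> \<inter> (\<Union>e\<in>enabled \<F> \<beta>. I (\<beta> @ [e])) = {}"
        by (auto simp: S_def I_def)
    qed (rule fin(3)[OF \<beta>])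
    moreover have "(\<Sum>m\<in>(\<Union>e\<in>enabled \<F> \<beta>. I (\<beta> @ [e])). ?M m) =
        (\<Sum>e\<in>enabled \<F> \<beta>. \<Sum>m\<in>I (\<beta> @ [e]). ?M m)"
    proof (rule sum.UNION_disjoint)
      show "finite (enabled \<F> \<beta>)" using fb \<beta> by (simp add: finitely_branching_def)
    qed (auto simp: fin(2), auto simp: I_def)
    ultimately show ?thesis
      by (simp add: q_def mass_sum)
  qed
  have "flow \<F> \<psi> q"
    unfolding flow_def
  proof (intro conjI allI impI ballI)
    show "0 \<le> \<psi> [] $ t" for t
      using root(3) by (simp add: \<psi>_def)
  next
    fix \<beta> e assume \<beta>: "\<beta> @ [e] \<in> traces \<F>"
    have "(\<Sum>n\<in>I (\<beta> @ [e]). \<Psi> n) = (\<Sum>n\<in>I (\<beta> @ [e]). \<Sum>t\<in>UNIV. Q n t)"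
      by (rule sum.cong) (auto simp: I_def \<Psi>)
    then show "\<psi> (\<beta> @ [e]) = (\<Sum>t\<in>UNIV. q (\<beta> @ [e]) t)"
      unfolding q_def by (subst sum.swap) (simp add: \<psi>_def)
    show "q (\<beta> @ [e]) t \<in> scaled (label \<F> e t)" for t
      unfolding q_def using label_convex[OF wl \<beta>] I_snoc(3) by (intro scaled_sum) auto
  next
    fix \<beta> t assume \<beta>: "\<beta> \<in> traces \<F> - max_traces \<F>"
    then have "{n \<in> N. Ch n = {} \<and> G n = \<beta>} = {}"
      using leaf by auto
    then show "(\<Sum>e\<in>enabled \<F> \<beta>. mass (q (\<beta> @ [e]) t) UNIV) = \<psi> \<beta> $ t"
      using balance[of \<beta> t] \<beta> by (simp only: sum.empty) simp
  qed
  moreover have "\<psi> \<beta> = (\<Sum>n | n \<in> N \<and> Ch n = {} \<and> G n = \<beta>. \<Psi> n)" if "\<beta> \<in> max_traces \<F>" for \<beta>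
    using balance[of \<beta>] that unfolding vec_eq_iff max_traces_iff by simp
  ultimately show thesis
    using that by (simp add: \<psi>_def)
qed

text \<open>Node \<open>(\<alpha>, k)\<close> stands for \<open>\<alpha>\<close>, if \<open>\<alpha>\<close> is maximal followed by \<open>k\<close> idle steps which are mapped to
  the first \<open>k\<close> of the events that lead from the weakly maximal trace \<open>f \<alpha>\<close> to a maximal one.\<close>

lemma flow_weak_simulation:
  fixes \<E> :: "('e, 's::finite) ipbes" and \<F> :: "('f, 's) ipbes"
  assumes f: "weak_simulation \<E> \<F> f"
    and wlE: "well_labelled \<E>" and wl: "well_labelled \<F>" and fb: "finitely_branching \<F>"
    and fl: "flow \<E> \<psi> q"
  obtains \<psi>' q' h where "flow \<F> \<psi>' q'" "\<psi>' [] = \<psi> []" "h \<in> max_traces \<E> \<rightarrow> max_traces \<F>"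
    "\<And>\<beta>. \<beta> \<in> max_traces \<F> \<Longrightarrow> finite {\<alpha> \<in> max_traces \<E>. h \<alpha> = \<beta>}"
    "\<And>\<beta>. \<beta> \<in> max_traces \<F> \<Longrightarrow> \<psi>' \<beta> = (\<Sum>\<alpha> | \<alpha> \<in> max_traces \<E> \<and> h \<alpha> = \<beta>. \<psi> \<alpha>)"
proof -
  have q: "\<psi> (\<alpha> @ [e]) = (\<Sum>t\<in>UNIV. q (\<alpha> @ [e]) t)" "q (\<alpha> @ [e]) t \<in> scaled (label \<E> e t)"
    if "\<alpha> @ [e] \<in> traces \<E>" for \<alpha> e t
    using fl that unfolding flow_def by blast+
  have bal: "(\<Sum>e\<in>enabled \<E> \<alpha>. mass (q (\<alpha> @ [e]) t) UNIV) = \<psi> \<alpha> $ t"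
    if "\<alpha> \<in> traces \<E>" "\<alpha> \<notin> max_traces \<E>" for \<alpha> t
    using fl that unfolding flow_def by blast
  obtain es where es: "f \<alpha> @ es \<alpha> \<in> max_traces \<F>" "\<forall>e\<in>set (es \<alpha>). skip \<sqsubseteq>\<^sub>H label \<F> e"
    if "\<alpha> \<in> max_traces \<E>" for \<alpha>
    using weak_simulationD(4)[OF f] unfolding weakly_maximal_iff by metis
  define l where "l \<alpha> = (if \<alpha> \<in> max_traces \<E> then length (es \<alpha>) else 0)" for \<alpha>
  define N where "N = {(\<alpha>, k). \<alpha> \<in> traces \<E> \<and> k \<le> l \<alpha>}"
  \<comment> \<open>A proper prefix is not maximal and has no idle steps, so
    \<open>(butlast \<alpha>, 0)\<close> is the only node of
    \<open>butlast \<alpha>\<close>.\<close>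
  define parent :: "'e list \<times> nat \<Rightarrow> 'e list \<times> nat" where
    "parent = (\<lambda>(\<alpha>, k). case k of 0 \<Rightarrow> (butlast \<alpha>, 0) | Suc j \<Rightarrow> (\<alpha>, j))"
  define G where "G = (\<lambda>(\<alpha>, k). f \<alpha> @ take k (es \<alpha>))"
  \<comment> \<open>An idle step splits \<open>\<psi> \<alpha>\<close> by states and leaves each
    state as it is.\<close>
  define Q where "Q = (\<lambda>(\<alpha>, k :: nat) t. if k = 0 then q \<alpha> t else (\<psi> \<alpha> $ t) *\<^sub>R point t)"
  define \<Psi> where "\<Psi> = (\<lambda>(\<alpha> :: 'e list, k :: nat). \<psi> \<alpha>)"
  define h where "h \<alpha> = f \<alpha> @ es \<alpha>" for \<alpha>
  have \<psi>_nonneg: "0 \<le> \<psi> \<alpha> $ t" if "\<alpha> \<in> traces \<E>" for \<alpha> t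
  proof (cases \<alpha> rule: rev_cases)
    case Nil
    then show ?thesis using fl by (simp add: flow_def)
  next
    case (snoc \<beta> e)
    then have "0 \<le> q (\<beta> @ [e]) u $ t" for u
      using that unfolding snoc by (intro scaled_nonneg[OF label_distributions[OF wlE] q(2)])
    then show ?thesis
      using q(1)[of \<beta> e] that by (simp add: snoc sum_nonneg)
  qed
  have N_cases: thesis
    if "n \<in> N" "n \<noteq> ([], 0)"
      and "\<And>\<alpha> e. n = (\<alpha> @ [e], 0) \<Longrightarrow> \<alpha> @ [e] \<in> traces \<E> \<Longrightarrow> thesis"
      and "\<And>\<alpha> k. n = (\<alpha>, Suc k) \<Longrightarrow> \<alpha> \<in> max_traces \<E> \<Longrightarrow> k < length (es \<alpha>) \<Longrightarrow> thesis"
    for n thesis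
  proof -
    obtain \<alpha> k where n: "n = (\<alpha>, k)" by fastforce
    show thesis
    proof (cases k)
      case 0
      then show thesis
        using that n by (cases \<alpha> rule: rev_cases) (auto simp: N_def)
    next
      case (Suc j)
      then show thesis
        using that(1) that(4)[of \<alpha> j] n by (auto simp: N_def l_def split: if_splits)
    qed
  qed
  have Ch_nonmax: "{m \<in> N. m \<noteq> ([], 0) \<and> parent m = (\<alpha>, k)} = (\<lambda>e. (\<alpha> @ [e], 0)) ` enabled \<E> \<alpha>"
    if "(\<alpha>, k) \<in> N" "\<alpha> \<notin> max_traces \<E>" for \<alpha> k
  proof -
    have "k = 0" using that by (simp add: N_def l_def)
    moreover have "m \<in> (\<lambda>e. (\<alpha> @ [e], 0)) ` enabled \<E> \<alpha>"
      if "m \<in> N" "m \<noteq> ([], 0)" "parent m = (\<alpha>, 0)" for m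
      using that(1,2) by (rule N_cases) (use that(3) \<open>\<alpha> \<notin> max_traces \<E>\<close> in \<open>auto simp: parent_def\<close>)
    ultimately show ?thesis
      by (auto simp: N_def parent_def)
  qed
  have Ch_max: "{m \<in> N. m \<noteq> ([], 0) \<and> parent m = (\<alpha>, k)} = (if k < length (es \<alpha>) then {(\<alpha>, Suc k)} else {})"
    if "(\<alpha>, k) \<in> N" "\<alpha> \<in> max_traces \<E>" for \<alpha> k
  proof -
    have *: "m = (\<alpha>, Suc k) \<and> k < length (es \<alpha>)"
      if "m \<in> N" "m \<noteq> ([], 0)" "parent m = (\<alpha>, k)" for m
      using that(1,2)
      by (rule N_cases) (use that(3) \<open>\<alpha> \<in> max_traces \<E>\<close> in \<open>auto simp: parent_def dest: snoc_not_max\<close>)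
    have "(\<alpha>, Suc k) \<in> {m \<in> N. m \<noteq> ([], 0) \<and> parent m = (\<alpha>, k)}" if "k < length (es \<alpha>)"
      using that \<open>(\<alpha>, k) \<in> N\<close> \<open>\<alpha> \<in> max_traces \<E>\<close> by (simp add: N_def parent_def l_def)
    then show ?thesis
      using * by (cases "k < length (es \<alpha>)") (simp, blast, simp, blast)
  qed
  have leaf_iff: "{m \<in> N. m \<noteq> ([], 0) \<and> parent m = n} = {} \<longleftrightarrow>
      (\<exists>\<alpha>\<in>max_traces \<E>. n = (\<alpha>, length (es \<alpha>)))" if "n \<in> N" for n
  proof -
    obtain \<alpha> k where n: "n = (\<alpha>, k)" by fastforce
    show ?thesis
    proof (cases "\<alpha> \<in> max_traces \<E>")
      case True
      then show ?thesis
        using Ch_max[of \<alpha> k] that by (auto simp: n N_def l_def)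
    next
      case False
      moreover from this have "enabled \<E> \<alpha> \<noteq> {}"
        using that by (simp add: n N_def max_traces_iff)
      ultimately show ?thesis
        using Ch_nonmax[of \<alpha> k] that by (simp add: n)
    qed
  qed
  have finG: "finite {n \<in> N. G n = \<beta>}" if "\<beta> \<in> traces \<F>" for \<beta>
  proof -
    \<comment> \<open>If a node over \<alpha> is mapped to \<beta>, then \<open>f \<alpha>\<close>
      is one of the finitely many prefixes of \<beta>.\<close>
    define A where "A = (\<Union>i\<le>length \<beta>. {\<alpha> \<in> traces \<E>. f \<alpha> = take i \<beta>})"
    have "take i \<beta> \<in> traces \<F>" for i
      using that by (metis append_take_drop_id traces_appendD)
    then have "finite A"
      using weak_simulationD(3)[OF f] by (simp add: A_def)
    moreover have "{n \<in> N. G n = \<beta>} \<subseteq> (SIGMA \<alpha>:A. {..l \<alpha>})"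
    proof
      fix n assume "n \<in> {n \<in> N. G n = \<beta>}"
      then obtain \<alpha> k where n: "n = (\<alpha>, k)" "\<alpha> \<in> traces \<E>" "k \<le> l \<alpha>" "\<beta> = f \<alpha> @ take k (es \<alpha>)"
        by (auto simp: N_def G_def)
      then have "f \<alpha> = take (length (f \<alpha>)) \<beta>" "length (f \<alpha>) \<le> length \<beta>" by simp_all
      then have "\<alpha> \<in> A" using n(2) unfolding A_def by blast
      then show "n \<in> (SIGMA \<alpha>:A. {..l \<alpha>})" using n by simp
    qed
    ultimately show ?thesis
      by (auto elim: finite_subset)
  qed
  have h: "h \<in> max_traces \<E> \<rightarrow> max_traces \<F>"
    using es(1) by (simp add: h_def)
  have fin_h: "finite {\<alpha> \<in> max_traces \<E>. h \<alpha> = \<beta>}" if "\<beta> \<in> max_traces \<F>" for \<beta>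
  proof -
    have "{\<alpha> \<in> max_traces \<E>. h \<alpha> = \<beta>} \<subseteq> fst ` {n \<in> N. G n = \<beta>}"
    proof
      fix \<alpha> assume "\<alpha> \<in> {\<alpha> \<in> max_traces \<E>. h \<alpha> = \<beta>}"
      then have "(\<alpha>, length (es \<alpha>)) \<in> {n \<in> N. G n = \<beta>}"
        by (auto simp: N_def G_def h_def l_def max_tracesD)
      then show "\<alpha> \<in> fst ` {n \<in> N. G n = \<beta>}" by force
    qed
    then show ?thesis
      using finG[OF max_tracesD[OF that]] by (auto intro: finite_subset)
  qed
  obtain \<psi>' q' where \<psi>': "flow \<F> \<psi>' q'" "\<psi>' [] = \<Psi> ([], 0)"
    "\<And>\<beta>. \<beta> \<in> max_traces \<F> \<Longrightarrow>
      \<psi>' \<beta> = (\<Sum>n | n \<in> N \<and> {m \<in> N. m \<noteq> ([], 0) \<and> parent m = n} = {} \<and> G n = \<beta>. \<Psi> n)"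
  proof (rule flow_pushforward[OF wl fb, where N = N and rt = "([], 0)" and parent = parent
        and G = G and Q = Q and \<Psi> = \<Psi>])
    show "([], 0) \<in> N" by (simp add: N_def)
    show "G ([], 0) = []" using weak_simulationD(2)[OF f] by (simp add: G_def)
    show "0 \<le> \<Psi> ([], 0) $ t" for t
      using \<psi>_nonneg by (simp add: \<Psi>_def)
  next
    fix n assume n: "n \<in> N" "n \<noteq> ([], 0)"
    show "parent n \<in> N"
      using n by (rule N_cases) (auto simp: parent_def N_def l_def max_tracesD dest: traces_snocD)
    show "\<Psi> n = (\<Sum>t\<in>UNIV. Q n t)"
      using n by (rule N_cases) (auto simp: \<Psi>_def Q_def q(1) sum_point_eq)
    show "(G n = G (parent n) \<and> (\<forall>t. Q n t \<in> scaled {point t})) \<or>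
        (\<exists>e'. G n = G (parent n) @ [e'] \<and> (\<forall>t. Q n t \<in> scaled (label \<F> e' t)))"
      using n
    proof (rule N_cases)
      fix \<alpha> e assume \<alpha>: "n = (\<alpha> @ [e], 0)" "\<alpha> @ [e] \<in> traces \<E>"
      show ?thesis
        using f \<alpha>(2)
      proof (cases rule: weak_simulation_snoc)
        case stutter
        have "scaled (label \<E> e t) \<subseteq> scaled {point t}" for t
          using stutter(2) by (intro scaled_mono) (simp add: prog_le_def skip_def)
        then show ?thesis
          using stutter(1) q(2)[OF \<alpha>(2)] by (auto simp: G_def Q_def parent_def \<alpha>(1))
      next
        case (step e')
        have "scaled (label \<E> e t) \<subseteq> scaled (label \<F> e' t)" for t
          using step(1) by (intro scaled_mono) (simp add: prog_le_def)
        then show ?thesis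
          using step(2) q(2)[OF \<alpha>(2)] by (auto simp: G_def Q_def parent_def \<alpha>(1))
      qed
    next
      fix \<alpha> k assume \<alpha>: "n = (\<alpha>, Suc k)" "\<alpha> \<in> max_traces \<E>" "k < length (es \<alpha>)"
      have "skip \<sqsubseteq>\<^sub>H label \<F> (es \<alpha> ! k)" using es(2) \<alpha>(2,3) by simp
      then have "point t \<in> scaled (label \<F> (es \<alpha> ! k) t)" for t
        using subset_scaled by (auto simp: prog_le_def skip_def)
      then have "Q n t \<in> scaled (label \<F> (es \<alpha> ! k) t)" for t
        using \<psi>_nonneg[OF max_tracesD[OF \<alpha>(2)]] by (simp add: Q_def \<alpha>(1) scaleR_in_scaled)
      then show ?thesis
        using \<alpha>(3) by (auto simp: G_def \<alpha>(1) parent_def take_Suc_conv_app_nth)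
    qed
  next
    fix n assume n: "n \<in> N"
    obtain \<alpha> k where \<alpha>: "n = (\<alpha>, k)" by fastforce
    show "G n \<in> traces \<F>"
    proof (cases "\<alpha> \<in> max_traces \<E>")
      case True
      have "(f \<alpha> @ take k (es \<alpha>)) @ drop k (es \<alpha>) \<in> traces \<F>"
        using max_tracesD[OF es(1)[OF True]] by simp
      from traces_appendD[OF this] show ?thesis by (simp add: G_def \<alpha>)
    next
      case False
      then show ?thesis
        using n weak_simulationD(1)[OF f] by (simp add: N_def l_def \<alpha> G_def)
    qed
    show "G n \<in> max_traces \<F>" if "{m \<in> N. m \<noteq> ([], 0) \<and> parent m = n} = {}"
      using that es(1) unfolding leaf_iff[OF n] by (auto simp: G_def)
    show "(\<Sum>m\<in>{m \<in> N. m \<noteq> ([], 0) \<and> parent m = n}. mass (Q m t) UNIV) = \<Psi> n $ t"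
      if "{m \<in> N. m \<noteq> ([], 0) \<and> parent m = n} \<noteq> {}" for t
    proof (cases "\<alpha> \<in> max_traces \<E>")
      case True
      then have "{m \<in> N. m \<noteq> ([], 0) \<and> parent m = n} = {(\<alpha>, Suc k)}"
        using Ch_max[of \<alpha> k] n that unfolding \<alpha> by (simp split: if_splits)
      then show ?thesis by (simp add: Q_def \<Psi>_def \<alpha>)
    next
      case False
      have "{m \<in> N. m \<noteq> ([], 0) \<and> parent m = n} = (\<lambda>e. (\<alpha> @ [e], 0)) ` enabled \<E> \<alpha>"
        using Ch_nonmax[of \<alpha> k] n False by (simp add: \<alpha>)
      then show ?thesis
        using bal[of \<alpha> t] n False
        by (simp add: sum.reindex inj_on_def Q_def \<Psi>_def \<alpha> N_def del: enabled_iff)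
    qed
  qed (use finG in simp_all)
  show thesis
  proof (rule that[OF \<psi>'(1) _ h fin_h])
    show "\<psi>' [] = \<psi> []" using \<psi>'(2) by (simp add: \<Psi>_def)
    fix \<beta> assume \<beta>: "\<beta> \<in> max_traces \<F>"
    have "{n \<in> N. {m \<in> N. m \<noteq> ([], 0) \<and> parent m = n} = {} \<and> G n = \<beta>} =
        (\<lambda>\<alpha>. (\<alpha>, length (es \<alpha>))) ` {\<alpha> \<in> max_traces \<E>. h \<alpha> = \<beta>}" (is "?A = ?B")
    proof -
      have "n \<in> ?A \<longleftrightarrow> n \<in> N \<and> (\<exists>\<alpha>\<in>max_traces \<E>. n = (\<alpha>, length (es \<alpha>))) \<and> G n = \<beta>" for n
        using leaf_iff[of n] by blast
      moreover have "(\<alpha>, length (es \<alpha>)) \<in> N" "G (\<alpha>, length (es \<alpha>)) = h \<alpha>" if "\<alpha> \<in> max_traces \<E>" for \<alpha>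
        using that by (auto simp: N_def l_def G_def h_def max_tracesD)
      ultimately show ?thesis by auto
    qed
    then show "\<psi>' \<beta> = (\<Sum>\<alpha> | \<alpha> \<in> max_traces \<E> \<and> h \<alpha> = \<beta>. \<psi> \<alpha>)"
      using \<psi>'(3)[OF \<beta>] by (simp add: sum.reindex inj_on_def \<Psi>_def)
  qed
qed

section \<open>Matching outcomes for one initial distribution\<close>

lemma has_sum_sum:
  fixes f :: "'i \<Rightarrow> 'a \<Rightarrow> 'b::topological_comm_monoid_add"
  assumes "\<And>i. i \<in> I \<Longrightarrow> (f i has_sum S i) A"
  shows "((\<lambda>x. \<Sum>i\<in>I. f i x) has_sum (\<Sum>i\<in>I. S i)) A"
  using assms by (induction I rule: infinite_finite_induct) (auto intro: has_sum_add)

lemma mix_phi_has_sum: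
  assumes "scheduler \<E> \<sigma>" "well_labelled \<E>" "finitely_branching \<E>"
  shows "(mix_phi \<nu> \<sigma> has_sum (\<Sum>s\<in>UNIV. \<nu> s *\<^sub>R outcome \<E> \<sigma> s)) (max_traces \<E>)"
  unfolding mix_phi_def[abs_def] by (intro has_sum_sum has_sum_scaleR phi_has_sum_outcome assms)

text \<open>A scheduler on \<open>\<F>\<close> does not know the initial state, so it can only match the behaviour of \<open>\<sigma>\<close>
  for one initial distribution.  Full support is what makes it terminate from every state.\<close>

lemma weak_simulation_outcome:
  fixes \<E> :: "('e, 's::finite) ipbes" and \<F> :: "('f, 's) ipbes"
  assumes f: "weak_simulation \<E> \<F> f"
    and wlE: "well_labelled \<E>" and wlF: "well_labelled \<F>"
    and fbF: "finitely_branching \<F>" and feas: "feasible \<F>"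
    and \<sigma>: "\<sigma> \<in> Sched1 \<E>"
    and \<nu>: "\<And>s. 0 < \<nu> s" "(\<Sum>s\<in>UNIV. \<nu> s) = 1"
  obtains \<sigma>' where "\<sigma>' \<in> Sched1 \<F>"
    "(\<Sum>s\<in>UNIV. \<nu> s *\<^sub>R outcome \<F> \<sigma>' s) = (\<Sum>s\<in>UNIV. \<nu> s *\<^sub>R outcome \<E> \<sigma> s)"
proof -
  have sched: "scheduler \<E> \<sigma>" and out: "\<And>s. outcome \<E> \<sigma> s \<in> distributions"
    using \<sigma> by (simp_all add: Sched1_def)
  have fbE: "finitely_branching \<E>"
    by (rule finitely_branching_weak_simulation[OF f fbF])
  have "0 \<le> \<nu> s" for s using \<nu>(1)[of s] by simp
  then obtain q where fl: "flow \<E> (mix_phi \<nu> \<sigma>) q"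
    using flow_of_scheduler[OF sched wlE fbE, of \<nu>] by blast
  obtain \<psi>' q' h where \<psi>': "flow \<F> \<psi>' q'" "\<psi>' [] = mix_phi \<nu> \<sigma> []"
    "h \<in> max_traces \<E> \<rightarrow> max_traces \<F>"
    "\<And>\<beta>. \<beta> \<in> max_traces \<F> \<Longrightarrow> finite {\<alpha> \<in> max_traces \<E>. h \<alpha> = \<beta>}"
    "\<And>\<beta>. \<beta> \<in> max_traces \<F> \<Longrightarrow> \<psi>' \<beta> = (\<Sum>\<alpha> | \<alpha> \<in> max_traces \<E> \<and> h \<alpha> = \<beta>. mix_phi \<nu> \<sigma> \<alpha>)"
    by (rule flow_weak_simulation[OF f wlE wlF fbF fl]) (rule that)
  obtain \<sigma>' where \<sigma>': "scheduler \<F> \<sigma>'" "\<And>\<alpha>. \<alpha> \<in> traces \<F> \<Longrightarrow> mix_phi (\<lambda>s. \<psi>' [] $ s) \<sigma>' \<alpha> = \<psi>' \<alpha>"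
    using scheduler_of_flow[OF \<psi>'(1) wlF fbF feas] by blast
  have mix': "mix_phi \<nu> \<sigma>' \<beta> = \<psi>' \<beta>" if "\<beta> \<in> traces \<F>" for \<beta>
    using \<sigma>'(2)[OF that] by (simp add: \<psi>'(2))
  let ?tot = "\<Sum>s\<in>UNIV. \<nu> s *\<^sub>R outcome \<E> \<sigma> s"
  \<comment> \<open>The maximal traces of \<E> are regrouped by their images under \<open>h\<close>;
    each finite group sums to the value of \<open>\<psi>'\<close>.\<close>
  have "((\<lambda>(\<beta>, \<alpha>). mix_phi \<nu> \<sigma> \<alpha>) has_sum ?tot)
      (SIGMA \<beta>:max_traces \<F>. {\<alpha> \<in> max_traces \<E>. h \<alpha> = \<beta>})"
    using mix_phi_has_sum[OF sched wlE fbE, of \<nu>] \<psi>'(3)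
    by (subst has_sum_reindex_bij_witness[where i = "\<lambda>\<alpha>. (h \<alpha>, \<alpha>)" and j = snd]) auto
  then have "(\<psi>' has_sum ?tot) (max_traces \<F>)"
    by (rule has_sum_SigmaD) (simp add: \<psi>'(4,5))
  then have "(mix_phi \<nu> \<sigma>' has_sum ?tot) (max_traces \<F>)"
    using mix' max_tracesD by (subst has_sum_cong[where g = \<psi>']) auto
  then have eq: "(\<Sum>s\<in>UNIV. \<nu> s *\<^sub>R outcome \<F> \<sigma>' s) = ?tot"
    by (rule has_sum_unique[OF mix_phi_has_sum[OF \<sigma>'(1) wlF fbF]])
  \<comment> \<open>The missing masses are non-negative and average to 0 under the strictly positive
    \<nu>, so each of them is 0.\<close>
  have "(\<Sum>s\<in>UNIV. \<nu> s * (1 - mass (outcome \<F> \<sigma>' s) UNIV)) = 0"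
  proof -
    have "(\<Sum>s\<in>UNIV. \<nu> s * mass (outcome \<F> \<sigma>' s) UNIV) = (\<Sum>s\<in>UNIV. \<nu> s * mass (outcome \<E> \<sigma> s) UNIV)"
      using arg_cong[OF eq, of "\<lambda>v. mass v UNIV"] by (simp add: mass_sum)
    also have "\<dots> = 1"
      using out by (simp add: distributions_mass \<nu>(2))
    finally show ?thesis
      by (simp add: right_diff_distrib sum_subtractf \<nu>(2))
  qed
  then have "\<nu> s * (1 - mass (outcome \<F> \<sigma>' s) UNIV) = 0" for s
    using mass_outcome_le_1[OF \<sigma>'(1) wlF fbF] \<nu>(1)
    by (subst (asm) sum_nonneg_eq_0_iff) (auto simp: less_imp_le)
  then have "mass (outcome \<F> \<sigma>' s) UNIV = 1" for s
    using \<nu>(1)[of s] by (metis eq_iff_diff_eq_0 less_irrefl mult_eq_0_iff)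
  then have "\<sigma>' \<in> Sched1 \<F>"
    using \<sigma>'(1) outcome_nonneg[OF \<sigma>'(1) wlF fbF] by (auto simp: Sched1_def intro: in_distributionsI)
  then show thesis
    using eq by (rule that)
qed

section \<open>Transfer of probability bounds\<close>

lemma prob_ge_semantics_iff:
  fixes \<E> :: "('e, 's::finite) ipbes"
  shows "prob_ge (\<lbrakk>\<E>\<rbrakk> s) S p \<longleftrightarrow> (\<forall>\<sigma>\<in>Sched1 \<E>. p \<le> mass (outcome \<E> \<sigma> s) S)"
proof
  assume "prob_ge (\<lbrakk>\<E>\<rbrakk> s) S p"
  moreover have "outcome \<E> \<sigma> s \<in> \<lbrakk>\<E>\<rbrakk> s" if "\<sigma> \<in> Sched1 \<E>" for \<sigma>
    unfolding semantics_def using that by (intro subsetD[OF closure_subset] hull_inc) blast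
  ultimately show "\<forall>\<sigma>\<in>Sched1 \<E>. p \<le> mass (outcome \<E> \<sigma> s) S"
    by (simp add: prob_ge_def)
next
  assume *: "\<forall>\<sigma>\<in>Sched1 \<E>. p \<le> mass (outcome \<E> \<sigma> s) S"
  interpret mass: bounded_linear "\<lambda>v :: real ^ 's. mass v S"
    by (rule bounded_linear_mass)
  \<comment> \<open>A lower bound on a mass cuts out a closed half-space, which absorbs convex hulls
    and closures.\<close>
  have "closed {\<mu> :: real ^ 's. p \<le> mass \<mu> S}"
    by (intro closed_Collect_le continuous_intros mass.continuous_on)
  moreover have "convex {\<mu> :: real ^ 's. p \<le> mass \<mu> S}"
    using convex_linear_vimage[OF mass.linear convex_real_interval(1)[of p]]
    by (simp add: vimage_def atLeast_def)
  ultimately have "\<lbrakk>\<E>\<rbrakk> s \<subseteq> {\<mu>. p \<le> mass \<mu> S}"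
    unfolding semantics_def using * by (intro closure_minimal hull_minimal) auto
  then show "prob_ge (\<lbrakk>\<E>\<rbrakk> s) S p"
    by (auto simp: prob_ge_def)
qed

lemma mass_mono_set:
  assumes "\<And>s. 0 \<le> \<mu> $ s" "S \<subseteq> T"
  shows "mass \<mu> S \<le> mass \<mu> T"
  unfolding mass_def using assms by (intro sum_mono2) (auto intro: finite_subset)

theorem prob_ge_weak_simulation:
  fixes \<E> :: "('e, 's::finite) ipbes" and \<F> :: "('f, 's) ipbes"
  assumes f: "weak_simulation \<E> \<F> f"
    and wlE: "well_labelled \<E>" and wlF: "well_labelled \<F>"
    and fbF: "finitely_branching \<F>" and feas: "feasible \<F>"
    and ge: "prob_ge (\<lbrakk>\<F>\<rbrakk> s\<^sub>0) S p"
  shows "prob_ge (\<lbrakk>\<E>\<rbrakk> s\<^sub>0) S p"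
  unfolding prob_ge_semantics_iff
proof (rule ballI, rule ccontr)
  fix \<sigma> assume \<sigma>: "\<sigma> \<in> Sched1 \<E>"
  define a where "a s = mass (outcome \<E> \<sigma> s) S" for s
  assume "\<not> p \<le> mass (outcome \<E> \<sigma> s\<^sub>0) S"
  then have d: "0 < p - a s\<^sub>0" by (simp add: a_def)
  \<comment> \<open>With d = \<open>p - a s\<^sub>0\<close> this solves (1 - c) * (1 + d) = 1 + d /
    2, which exceeds 1; a fixed \<nu> thus replaces a limit.\<close>
  define c where "c = (p - a s\<^sub>0) / (2 * (1 + (p - a s\<^sub>0)))"
  have c: "0 < c" "c < 1"
    using d by (simp_all add: c_def field_simps)
  \<comment> \<open>The uniform part provides full support.\<close>
  define \<nu> where "\<nu> s = (if s = s\<^sub>0 then 1 - c else 0) + c / CARD('s)" for s :: 's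
  have \<nu>: "0 < \<nu> s" "(\<Sum>s\<in>UNIV. \<nu> s) = 1" for s
    using c by (simp_all add: \<nu>_def sum.distrib add_nonneg_pos)
  obtain \<sigma>' where \<sigma>': "\<sigma>' \<in> Sched1 \<F>"
    "(\<Sum>s\<in>UNIV. \<nu> s *\<^sub>R outcome \<F> \<sigma>' s) = (\<Sum>s\<in>UNIV. \<nu> s *\<^sub>R outcome \<E> \<sigma> s)"
    using weak_simulation_outcome[OF f wlE wlF fbF feas \<sigma> \<nu>] by blast
  define b where "b s = mass (outcome \<F> \<sigma>' s) S" for s
  have b: "p \<le> b s\<^sub>0" "0 \<le> b s" for s
    using ge \<sigma>'(1) unfolding prob_ge_semantics_iff b_def Sched1_def
    by (auto intro!: mass_nonneg distributions_nonneg)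
  have a: "a s \<le> 1" for s
  proof -
    have out: "outcome \<E> \<sigma> s \<in> distributions" using \<sigma> by (simp add: Sched1_def)
    then show ?thesis
      using mass_mono_set[of "outcome \<E> \<sigma> s" S UNIV] distributions_nonneg distributions_mass
      by (fastforce simp: a_def)
  qed
  \<comment> \<open>The averages of \<open>a\<close> and \<open>b\<close> agree. Dropping the other
    states on the \<open>b\<close> side and bounding \<open>a\<close> by 1 there leaves \<nu> * p
    \<le> \<nu> * a + 1 - \<nu> at \<open>s\<^sub>0\<close>.\<close>
  have "\<nu> s\<^sub>0 * p \<le> \<nu> s\<^sub>0 * b s\<^sub>0"
    using b(1) \<nu>(1)[of s\<^sub>0] by simp
  also have "\<dots> \<le> (\<Sum>s\<in>UNIV. \<nu> s * b s)"
    using b(2) \<nu>(1) by (intro member_le_sum) (auto simp: less_imp_le)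
  also have "\<dots> = (\<Sum>s\<in>UNIV. \<nu> s * a s)"
    using arg_cong[OF \<sigma>'(2), of "\<lambda>v. mass v S"] by (simp add: mass_sum a_def b_def)
  also have "\<dots> = \<nu> s\<^sub>0 * a s\<^sub>0 + (\<Sum>s\<in>UNIV - {s\<^sub>0}. \<nu> s * a s)"
    by (rule sum.remove) auto
  also have "\<dots> \<le> \<nu> s\<^sub>0 * a s\<^sub>0 + (\<Sum>s\<in>UNIV - {s\<^sub>0}. \<nu> s)"
    using a \<nu>(1) by (intro add_left_mono sum_mono mult_left_le) (auto simp: less_imp_le)
  also have "(\<Sum>s\<in>UNIV - {s\<^sub>0}. \<nu> s) = 1 - \<nu> s\<^sub>0"
    using sum.remove[of UNIV s\<^sub>0 \<nu>] \<nu>(2) by simp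
  finally have "\<nu> s\<^sub>0 * (1 + (p - a s\<^sub>0)) \<le> 1"
    by (simp add: algebra_simps)
  moreover have "(1 - c) * (1 + (p - a s\<^sub>0)) \<le> \<nu> s\<^sub>0 * (1 + (p - a s\<^sub>0))"
    using c d by (intro mult_right_mono) (auto simp: \<nu>_def)
  moreover have "(1 - c) * (1 + (p - a s\<^sub>0)) = 1 + (p - a s\<^sub>0) / 2"
    using d by (simp add: c_def field_simps)
  ultimately have "1 + (p - a s\<^sub>0) / 2 \<le> 1"
    by (metis order_trans)
  then show False
    using d by simp
qed

text \<open>Inclusion-exclusion, with the mass of the union at most 1.\<close>

lemma mass_Int_ge:
  assumes "\<mu> \<in> distributions"
  shows "mass \<mu> S + mass \<mu> T - 1 \<le> mass \<mu> (S \<inter> T)"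
proof -
  have "mass \<mu> S + mass \<mu> T = mass \<mu> (S \<union> T) + mass \<mu> (S \<inter> T)"
    unfolding mass_def by (rule sum.union_inter[symmetric]) auto
  moreover have "mass \<mu> (S \<union> T) \<le> 1"
    using mass_mono_set[of \<mu> "S \<union> T" UNIV] assms distributions_nonneg distributions_mass
    by fastforce
  ultimately show ?thesis by simp
qed

text \<open>The loop of \<open>m\<close> and the component \<F> are both simulated by the star of
  \<open>r\<close>, so their merge is too by \<open>choice_self\<close>; \<E> is carried along
  unchanged. The simulation of \<E> by a star supplies finite branching.\<close>

lemma prob_ge_star_par:
  fixes \<E> :: "('e, 's::finite) ipbes" and \<F> :: "('f, 's) ipbes"
  assumes wl: "well_labelled \<E>" "well_labelled \<F>" and feas: "feasible \<E>"
    and H1: "m \<in> H1" "r \<in> H1" and mr: "m \<sqsubseteq>\<^sub>H r"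
    and \<E>: "weak_simulation \<E> (star g) u"
    and \<F>: "weak_simulation \<F> (star g') v" "weak_simulation (star g') (star r) v'"
    and ge: "prob_ge (\<lbrakk>star r \<parallel> \<E>\<rbrakk> s) S p"
  shows "prob_ge (\<lbrakk>star m \<parallel> \<F> \<parallel> \<E>\<rbrakk> s) S p"
proof (rule prob_ge_weak_simulation[OF _ _ _ _ _ ge])
  have "weak_simulation (star m \<parallel> \<F>) (star (choice r r))
      (merge (max_traces (star m \<parallel> \<F>)) id (v' \<circ> v))"
    by (rule weak_simulation_merge[OF weak_simulation_star_mono[OF mr]
          weak_simulation_trans_star[OF \<F>] H1(2) H1(2)])
  then show "weak_simulation (star m \<parallel> \<F> \<parallel> \<E>) (star r \<parallel> \<E>)
      (sim_left (merge (max_traces (star m \<parallel> \<F>)) id (v' \<circ> v)))"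
    unfolding choice_self[OF H1(2)] by (rule weak_simulation_par_left)
  show "well_labelled (star m \<parallel> \<F> \<parallel> \<E>)" "well_labelled (star r \<parallel> \<E>)"
    by (intro well_labelled_par well_labelled_star wl H1)+
  show "finitely_branching (star r \<parallel> \<E>)"
    by (rule finitely_branching_par[OF finitely_branching_star
          finitely_branching_weak_simulation[OF \<E> finitely_branching_star]])
  show "feasible (star r \<parallel> \<E>)"
    by (intro feasible_par feasible_star feas)
qed

theorem proposition7p1:
  fixes \<E>\<^sub>1 :: "('e, 's::finite) ipbes" and \<E>\<^sub>2 :: "('f, 's) ipbes"
    and r\<^sub>1 r\<^sub>2 g g' :: "'s prog" and p\<^sub>1 p\<^sub>2 :: real
    and s\<^sub>0 :: 's and O\<^sub>1 O\<^sub>2 :: "'s set"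
  assumes "concurrent_program \<E>\<^sub>1" and "concurrent_program \<E>\<^sub>2"
    and "r\<^sub>1 \<in> H1" and "r\<^sub>2 \<in> H1" and "g \<in> H1" and "g' \<in> H1"
    and "meet r\<^sub>1 r\<^sub>2 \<in> H1"
    and "p\<^sub>1 \<in> {0..1}" and "p\<^sub>2 \<in> {0..1}"
    and "prob_ge (\<lbrakk>star r\<^sub>1 \<parallel> \<E>\<^sub>1\<rbrakk> s\<^sub>0) O\<^sub>1 p\<^sub>1"
    and "prob_ge (\<lbrakk>star r\<^sub>2 \<parallel> \<E>\<^sub>2\<rbrakk> s\<^sub>0) O\<^sub>2 p\<^sub>2"
    and "\<E>\<^sub>1 \<sqsubseteq>\<^sub>s\<^sub>i\<^sub>m star g" and "star g \<sqsubseteq>\<^sub>s\<^sub>i\<^sub>m star r\<^sub>2"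
    and "\<E>\<^sub>2 \<sqsubseteq>\<^sub>s\<^sub>i\<^sub>m star g'" and "star g' \<sqsubseteq>\<^sub>s\<^sub>i\<^sub>m star r\<^sub>1"
  shows "prob_ge (\<lbrakk>star (meet r\<^sub>1 r\<^sub>2) \<parallel> \<E>\<^sub>1 \<parallel> \<E>\<^sub>2\<rbrakk> s\<^sub>0) (O\<^sub>1 \<inter> O\<^sub>2) (p\<^sub>1 + p\<^sub>2 - 1) \<and>
         \<E>\<^sub>1 \<parallel> \<E>\<^sub>2 \<sqsubseteq>\<^sub>s\<^sub>i\<^sub>m star (choice g g')"
proof
  let ?m = "meet r\<^sub>1 r\<^sub>2"
  obtain u u' v v' where sims: "t_simulation \<E>\<^sub>1 (star g) u" "t_simulation (star g) (star r\<^sub>2) u'"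
    "t_simulation \<E>\<^sub>2 (star g') v" "t_simulation (star g') (star r\<^sub>1) v'"
    using assms(12-15) unfolding simulated_by_def by blast
  note wsims = sims[THEN t_simulation_imp_weak]
  show "\<E>\<^sub>1 \<parallel> \<E>\<^sub>2 \<sqsubseteq>\<^sub>s\<^sub>i\<^sub>m star (choice g g')"
    using t_simulation_merge[OF sims(1,3) assms(5,6)] unfolding simulated_by_def by blast
  have wl: "well_labelled \<E>\<^sub>1" "well_labelled \<E>\<^sub>2" and feas: "feasible \<E>\<^sub>1" "feasible \<E>\<^sub>2"
    using assms(1,2) by (simp_all add: concurrent_program_def is_ipbes_def well_labelled_def)
  have m: "?m \<sqsubseteq>\<^sub>H r\<^sub>1" "?m \<sqsubseteq>\<^sub>H r\<^sub>2"
    by (simp_all add: prog_le_def meet_def)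
  have "prob_ge (\<lbrakk>star ?m \<parallel> \<E>\<^sub>1 \<parallel> \<E>\<^sub>2\<rbrakk> s\<^sub>0) O\<^sub>1 p\<^sub>1"
  \<comment> \<open>For \<open>O\<^sub>1\<close> the star must absorb \<open>\<E>\<^sub>2\<close>,
    which is not its neighbour in the composition.\<close>
  proof (rule prob_ge_weak_simulation[OF weak_simulation_par_swap])
    show "prob_ge (\<lbrakk>star ?m \<parallel> \<E>\<^sub>2 \<parallel> \<E>\<^sub>1\<rbrakk> s\<^sub>0) O\<^sub>1 p\<^sub>1"
      by (rule prob_ge_star_par[OF wl feas(1) assms(7,3) m(1) wsims(1,3,4) assms(10)])
    show "well_labelled (star ?m \<parallel> \<E>\<^sub>1 \<parallel> \<E>\<^sub>2)" "well_labelled (star ?m \<parallel> \<E>\<^sub>2 \<parallel> \<E>\<^sub>1)"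
      by (intro well_labelled_par well_labelled_star wl assms(7))+
    show "finitely_branching (star ?m \<parallel> \<E>\<^sub>2 \<parallel> \<E>\<^sub>1)"
      using wsims(1,3)[THEN finitely_branching_weak_simulation, OF finitely_branching_star]
      by (intro finitely_branching_par finitely_branching_star)
    show "feasible (star ?m \<parallel> \<E>\<^sub>2 \<parallel> \<E>\<^sub>1)"
      by (intro feasible_par feasible_star feas)
  qed
  moreover have "prob_ge (\<lbrakk>star ?m \<parallel> \<E>\<^sub>1 \<parallel> \<E>\<^sub>2\<rbrakk> s\<^sub>0) O\<^sub>2 p\<^sub>2"
    by (rule prob_ge_star_par[OF wl(2,1) feas(2) assms(7,4) m(2) wsims(3,1,2) assms(11)])
  ultimately show "prob_ge (\<lbrakk>star ?m \<parallel> \<E>\<^sub>1 \<parallel> \<E>\<^sub>2\<rbrakk> s\<^sub>0) (O\<^sub>1 \<inter> O\<^sub>2) (p\<^sub>1 + p\<^sub>2 - 1)"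
    unfolding prob_ge_semantics_iff
  proof (intro ballI)
    fix \<sigma> assume *: "\<forall>\<sigma>\<in>Sched1 (star ?m \<parallel> \<E>\<^sub>1 \<parallel> \<E>\<^sub>2). p\<^sub>1 \<le> mass (outcome (star ?m \<parallel> \<E>\<^sub>1 \<parallel> \<E>\<^sub>2) \<sigma> s\<^sub>0) O\<^sub>1"
      "\<forall>\<sigma>\<in>Sched1 (star ?m \<parallel> \<E>\<^sub>1 \<parallel> \<E>\<^sub>2). p\<^sub>2 \<le> mass (outcome (star ?m \<parallel> \<E>\<^sub>1 \<parallel> \<E>\<^sub>2) \<sigma> s\<^sub>0) O\<^sub>2"
    assume \<sigma>: "\<sigma> \<in> Sched1 (star ?m \<parallel> \<E>\<^sub>1 \<parallel> \<E>\<^sub>2)"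
    then have "outcome (star ?m \<parallel> \<E>\<^sub>1 \<parallel> \<E>\<^sub>2) \<sigma> s\<^sub>0 \<in> distributions"
      by (simp add: Sched1_def)
    from mass_Int_ge[OF this, of O\<^sub>1 O\<^sub>2] *[rule_format, OF \<sigma>]
    show "p\<^sub>1 + p\<^sub>2 - 1 \<le> mass (outcome (star ?m \<parallel> \<E>\<^sub>1 \<parallel> \<E>\<^sub>2) \<sigma> s\<^sub>0) (O\<^sub>1 \<inter> O\<^sub>2)"
      by linarith
  qed
qed

end
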